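(* Let $p$ be a positive real number and $A\in L^q(D,\mathbb{B})$ with $q>2$. Every function $w\in H^p_{A,0}(D,\mathbb{B})$ is an element of $L^m(D,\mathbb{B})$ for every $0<m<2p$.
   Context: $D$ is the open unit disk in $\mathbb{C}$. $\frac{\partial}{\partial z}=\frac12(\partial_x-i\partial_y)$, $\frac{\partial}{\partial z^*}=\frac12(\partial_x+i\partial_y)$. $\mathbb{B}$ denotes the bicomplex numbers: the commutative $\mathbb{C}$-algebra of elements $z_1+jz_2$ with $z_1,z_2\in\mathbb{C}$, $j^2=-1$, $ij=ji$. Put $p^\pm=\frac12(1\pm ij)$ (idempotents with $p^+p^-=0$). Each $w=z_1+jz_2\in\mathbb{B}$ is uniquely $w=p^+w^++p^-w^-$ with $w^\pm=z_1\mp iz_2\in\mathbb{C}$. $\|w\|_{\mathbb{B}}=\sqrt{(|w^+|^2+|w^-|^2)/2}$. For $0<m<\infty$, $L^m(D,\mathbb{B})$ is the set of $f:D\to\mathbb{B}$ with $\iint_D\|f\|_{\mathbb{B}}^m\,dx\,dy<\infty$. $\bar\partial=\frac12(\partial_x+j\partial_y)=p^+\frac{\partial}{\partial z}+p^-\frac{\partial}{\partial z^*}$, derivatives being understood in the weak sense. $H^p_{A,0}(D,\mathbb{B})$ is the set of $f:D\to\mathbb{B}$ with $\bar\partial f=Af$ on $D$ (taken with their continuous representatives) and $\sup_{0<r<1}\int_0^{2\pi}\|f(re^{i\theta})\|_{\mathbb{B}}^p\,d\theta<\infty$. *)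

theory Defs
  imports "HOL-Analysis.Analysis"
begin

section \<open>Bicomplex numbers\<close>

text \<open>\<open>Bicomplex z1 z2\<close> stands for \<open>z1 + j z2\<close>.\<close>

datatype bicomplex = Bicomplex (bc_fst: complex) (bc_snd: complex)

lemma bicomplex_eq_iff: "w = v \<longleftrightarrow> bc_fst w = bc_fst v \<and> bc_snd w = bc_snd v"
  by (cases w; cases v) simp

definition bc_of_complex :: "complex \<Rightarrow> bicomplex" where
  "bc_of_complex z = Bicomplex z 0"

definition bc_j :: bicomplex where
  "bc_j = Bicomplex 0 1"

text \<open>\<open>bc_plus\<close> and \<open>bc_minus\<close> are the components with respect to the idempotents
  \<open>(1 \<plusminus> i j)/2\<close>, see \<open>bicomplex_idempotent_decompose\<close> below.\<close>

definition bc_plus :: "bicomplex \<Rightarrow> complex" where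
  "bc_plus w = bc_fst w - \<i> * bc_snd w"

definition bc_minus :: "bicomplex \<Rightarrow> complex" where
  "bc_minus w = bc_fst w + \<i> * bc_snd w"

instantiation bicomplex :: comm_ring_1
begin

definition "0 = Bicomplex 0 0"
definition "1 = Bicomplex 1 0"
definition "w + v = Bicomplex (bc_fst w + bc_fst v) (bc_snd w + bc_snd v)"
definition "- w = Bicomplex (- bc_fst w) (- bc_snd w)"
definition "w - v = Bicomplex (bc_fst w - bc_fst v) (bc_snd w - bc_snd v)"
definition "w * v = Bicomplex (bc_fst w * bc_fst v - bc_snd w * bc_snd v)
                              (bc_fst w * bc_snd v + bc_snd w * bc_fst v)"

instance
  by standard
    (simp_all add: zero_bicomplex_def one_bicomplex_def plus_bicomplex_def uminus_bicomplex_def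
      minus_bicomplex_def times_bicomplex_def bicomplex_eq_iff algebra_simps)

end

instantiation bicomplex :: real_inner
begin

definition "r *\<^sub>R w = Bicomplex (r *\<^sub>R bc_fst w) (r *\<^sub>R bc_snd w)"
definition "norm w = sqrt (((cmod (bc_plus w))\<^sup>2 + (cmod (bc_minus w))\<^sup>2) / 2)"
definition "inner w v = (inner (bc_plus w) (bc_plus v) + inner (bc_minus w) (bc_minus v)) / 2"
definition "sgn (w :: bicomplex) = inverse (norm w) *\<^sub>R w"
definition "dist w (v :: bicomplex) = norm (w - v)"
definition
  "(uniformity :: (bicomplex \<times> bicomplex) filter) = (INF e\<in>{0<..}. principal {(x, y). dist x y < e})"
definition
  "open (U :: bicomplex set) \<longleftrightarrow> (\<forall>x\<in>U. eventually (\<lambda>(x', y). x' = x \<longrightarrow> y \<in> U) uniformity)"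

instance
proof
  fix w v u :: bicomplex and r s :: real
  note defs = zero_bicomplex_def plus_bicomplex_def scaleR_bicomplex_def bc_plus_def bc_minus_def
    inner_bicomplex_def
  show "r *\<^sub>R (w + v) = r *\<^sub>R w + r *\<^sub>R v" "(r + s) *\<^sub>R w = r *\<^sub>R w + s *\<^sub>R w"
    "r *\<^sub>R s *\<^sub>R w = (r * s) *\<^sub>R w" "1 *\<^sub>R w = w"
    by (simp_all add: defs bicomplex_eq_iff algebra_simps)
  show "inner w v = inner v w"
    by (simp add: defs inner_commute)
  {
    have "bc_plus (w + v) = bc_plus w + bc_plus v" "bc_minus (w + v) = bc_minus w + bc_minus v"
      "bc_plus (r *\<^sub>R w) = r *\<^sub>R bc_plus w" "bc_minus (r *\<^sub>R w) = r *\<^sub>R bc_minus w"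
      by (simp_all add: defs algebra_simps)
    then show "inner (w + v) u = inner w u + inner v u" "inner (r *\<^sub>R w) v = r * inner w v"
      by (simp_all only: inner_bicomplex_def inner_add_left inner_scaleR_left)
        (simp_all add: add_divide_distrib distrib_left)
  }
  show "0 \<le> inner w w"
    by (simp add: defs)
  have "inner w w = 0 \<longleftrightarrow> inner (bc_plus w) (bc_plus w) = 0 \<and> inner (bc_minus w) (bc_minus w) = 0"
    by (simp add: inner_bicomplex_def add_nonneg_eq_0_iff del: inner_eq_zero_iff)
  also have "\<dots> \<longleftrightarrow> w = 0"
    by (auto simp: defs bicomplex_eq_iff complex_eq_iff)
  finally show "inner w w = 0 \<longleftrightarrow> w = 0" .
  show "norm w = sqrt (inner w w)"
    by (simp add: norm_bicomplex_def inner_bicomplex_def dot_square_norm)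
qed (simp_all add: dist_bicomplex_def sgn_bicomplex_def uniformity_bicomplex_def open_bicomplex_def)

end

lemma inner_bicomplex_eq:
  "inner w v = inner (bc_fst w) (bc_fst v) + inner (bc_snd w) (bc_snd v)"
  by (simp add: inner_bicomplex_def bc_plus_def bc_minus_def inner_complex_def algebra_simps)

instantiation bicomplex :: euclidean_space
begin

definition "Basis = {Bicomplex 1 0, Bicomplex \<i> 0, Bicomplex 0 1, Bicomplex 0 \<i>}"

instance
proof
  fix u v x :: bicomplex
  show "(Basis :: bicomplex set) \<noteq> {}" "finite (Basis :: bicomplex set)"
    by (simp_all add: Basis_bicomplex_def)
  assume "u \<in> Basis" "v \<in> Basis"
  then show "inner u v = (if u = v then 1 else 0)"
    unfolding Basis_bicomplex_def insert_iff empty_iff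
    by (elim disjE) (simp_all add: inner_bicomplex_eq inner_complex_def complex_eq_iff)
next
  fix x :: bicomplex
  show "(\<forall>u\<in>Basis. inner x u = 0) \<longleftrightarrow> x = 0"
    by (cases x) (auto simp: Basis_bicomplex_def inner_bicomplex_eq inner_complex_def
      zero_bicomplex_def complex_eq_iff)
qed

end

lemma bicomplex_decompose:
  "Bicomplex z1 z2 = bc_of_complex z1 + bc_j * bc_of_complex z2"
  by (simp add: bc_of_complex_def bc_j_def plus_bicomplex_def times_bicomplex_def)

lemma bc_j_squared: "bc_j * bc_j = - 1"
  by (simp add: bc_j_def times_bicomplex_def uminus_bicomplex_def one_bicomplex_def)

lemma bicomplex_idempotent_decompose:
  "w = ((1/2) *\<^sub>R (1 + bc_of_complex \<i> * bc_j)) * bc_of_complex (bc_plus w)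
     + ((1/2) *\<^sub>R (1 - bc_of_complex \<i> * bc_j)) * bc_of_complex (bc_minus w)"
  by (simp add: bicomplex_eq_iff bc_of_complex_def bc_j_def bc_plus_def bc_minus_def
      plus_bicomplex_def minus_bicomplex_def times_bicomplex_def one_bicomplex_def
      scaleR_bicomplex_def complex_eq_iff)
    (simp add: field_simps)


section \<open>The weak bicomplex d-bar operator\<close>

primrec Ck :: "nat \<Rightarrow> ('a::real_normed_vector \<Rightarrow> 'b::real_normed_vector) \<Rightarrow> bool" where
  "Ck 0 f \<longleftrightarrow> continuous_on UNIV f"
| "Ck (Suc k) f \<longleftrightarrow> (\<forall>x. f differentiable (at x)) \<and> (\<forall>v. Ck k (\<lambda>x. frechet_derivative f (at x) v))"

definition test_function_on :: "complex set \<Rightarrow> (complex \<Rightarrow> complex) \<Rightarrow> bool" where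
  "test_function_on S \<phi> \<longleftrightarrow>
     (\<forall>k. Ck k \<phi>) \<and> compact (closure {z. \<phi> z \<noteq> 0}) \<and> closure {z. \<phi> z \<noteq> 0} \<subseteq> S"

text \<open>The directional derivatives along \<open>1\<close> and \<open>\<i>\<close> are the partial derivatives in \<open>x\<close> and \<open>y\<close>.\<close>

definition bc_dbar :: "(complex \<Rightarrow> complex) \<Rightarrow> complex \<Rightarrow> bicomplex" where
  "bc_dbar \<phi> z = (1/2) *\<^sub>R (bc_of_complex (frechet_derivative \<phi> (at z) 1)
                        + bc_j * bc_of_complex (frechet_derivative \<phi> (at z) \<i>))"

definition locally_integrable_on :: "complex set \<Rightarrow> (complex \<Rightarrow> bicomplex) \<Rightarrow> bool" where
  "locally_integrable_on S f \<longleftrightarrow> (\<forall>K. compact K \<and> K \<subseteq> S \<longrightarrow> integrable (lebesgue_on K) f)"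

text \<open>\<open>has_weak_dbar S f g\<close>: the distributional derivative of \<open>f\<close> on the open set \<open>S\<close> under
  \<open>(\<partial>\<^sub>x + j \<partial>\<^sub>y)/2\<close> is the locally integrable function \<open>g\<close>.\<close>

definition has_weak_dbar ::
    "complex set \<Rightarrow> (complex \<Rightarrow> bicomplex) \<Rightarrow> (complex \<Rightarrow> bicomplex) \<Rightarrow> bool" where
  "has_weak_dbar S f g \<longleftrightarrow>
     locally_integrable_on S f \<and> locally_integrable_on S g \<and>
     (\<forall>\<phi>. test_function_on S \<phi> \<longrightarrow>
        integral\<^sup>L (lebesgue_on S) (\<lambda>z. f z * bc_dbar \<phi> z) =
        - integral\<^sup>L (lebesgue_on S) (\<lambda>z. g z * bc_of_complex (\<phi> z)))"


section \<open>Function spaces on the unit disk\<close>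

text \<open>Functions on the disk are total functions of which only the values on \<open>ball 0 1\<close> matter.\<close>

definition Lspace_disk :: "real \<Rightarrow> (complex \<Rightarrow> bicomplex) set" where
  "Lspace_disk m = {f. f \<in> borel_measurable (lebesgue_on (ball 0 1)) \<and>
     (\<integral>\<^sup>+ z. ennreal (norm (f z) powr m) \<partial>lebesgue_on (ball 0 1)) < \<infinity>}"

definition Hardy_disk :: "real \<Rightarrow> (complex \<Rightarrow> bicomplex) \<Rightarrow> (complex \<Rightarrow> bicomplex) set" where
  "Hardy_disk p A = {f. continuous_on (ball 0 1) f \<and>
     has_weak_dbar (ball 0 1) f (\<lambda>z. A z * f z) \<and>
     (SUP r\<in>{0<..<1}. \<integral>\<^sup>+ \<theta>. ennreal (norm (f (rcis r \<theta>)) powr p) \<partial>lebesgue_on {0..2*pi}) < \<infinity>}"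

end

theory Submission
  imports Defs
begin

text \<open>
  The theorem rests on the growth bound \<open>\<parallel>w z\<parallel>\<^sup>p \<le> B / (1 - |z|)\<close>. Given that bound, put
  \<open>s = (m - p) / p\<close> for \<open>p \<le> m < 2 p\<close>; then \<open>\<parallel>w\<parallel>\<^sup>m = (\<parallel>w\<parallel>\<^sup>p)\<^sup>s \<parallel>w\<parallel>\<^sup>p\<close> is at most a multiple of
  \<open>(1 - |z|) powr (- s) \<parallel>w\<parallel>\<^sup>p\<close>. The weight is radial, so integrating over circles first and using
  the Hardy condition leaves \<open>\<integral> (1 - |z|) powr (- s)\<close> over the disk, which is finite precisely
  because \<open>s < 1\<close>, that is \<open>m < 2 p\<close>. Exponents below \<open>p\<close> follow as the disk has finite area.

  For a holomorphic function the growth bound is the sub-mean-value property of \<open>|h|\<^sup>p\<close> on a disk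
  of radius comparable to \<open>1 - |z|\<close>, whose integral the Hardy condition controls through the
  annulus that contains the disk. The bulk of the text proves this property, up to constants, for
  continuous weak solutions of \<open>\<partial>w = A w\<close>; the bound holds for all \<open>p > 0\<close> and on all disks below
  a radius that depends on \<open>A\<close>. The classical route factors \<open>w\<close> as a bounded factor times a
  holomorphic function. The route here avoids the factorization:

  \<^item> Testing the equation against a truncated Cauchy kernel gives a Cauchy-Pompeiu inequality
    (\<open>weak_dbar_center_estimate\<close>): \<open>\<parallel>w z\<parallel>\<close> is bounded by the mean of \<open>\<parallel>w\<parallel>\<close> over the disk of radius
    \<open>r\<close> about \<open>z\<close> plus the integral of \<open>\<parallel>A w\<parallel> / |\<zeta> - z|\<close> over the same disk. The bicomplex numbers
    \<open>x - j y\<close> form a copy of the complex plane on which the norm is multiplicative, so the kernel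
    is treated exactly as in the complex case and the idempotent components stay together.

  \<^item> Since \<open>q > 2\<close>, the integral of \<open>\<parallel>A\<parallel> / |\<zeta> - z|\<close> over a small disk is small, uniformly in \<open>z\<close>
    (\<open>cauchy_kernel_small\<close>). The second term can therefore be absorbed into the left side,
    provided that \<open>\<parallel>w\<parallel>\<close> on the disk is bounded by a fixed multiple of its value at the centre.

  \<^item> That proviso is arranged by moving the centre to a maximum point of
    \<open>\<parallel>w \<zeta>\<parallel> (\<rho> - |\<zeta> - z\<^sub>0|) powr (2 / p)\<close> (\<open>weighted_maximum\<close>). The exponent \<open>2 / p\<close> is the one for
    which the estimate at the new centre and scale implies the one at \<open>z\<^sub>0\<close>, and the comparison
    with the central value also turns the mean of \<open>\<parallel>w\<parallel>\<close> into one of \<open>\<parallel>w\<parallel>\<^sup>p\<close> for every \<open>p > 0\<close>.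
\<close>

section \<open>Calculus of smooth functions\<close>

lemma Ck_lower: "Ck (Suc k) f \<Longrightarrow> Ck k f"
proof (induction k arbitrary: f)
  case 0
  then have "\<forall>x. f differentiable (at x)" by simp
  then show ?case
    by (simp add: continuous_at_imp_continuous_on differentiable_imp_continuous_within)
next
  case (Suc k)
  then show ?case by (metis Ck.simps(2))
qed

lemma Ck_SucI:
  assumes "\<And>x. (f has_derivative f' x) (at x)" "\<And>v. Ck k (\<lambda>x. f' x v)"
  shows "Ck (Suc k) f"
proof -
  have "frechet_derivative f (at x) = f' x" for x
    using assms(1) by (metis frechet_derivative_at)
  then show ?thesis
    using assms by (auto simp: differentiable_def)
qed

lemma Ck_const: "Ck k (\<lambda>x. c)"
  by (induction k arbitrary: c) (auto intro!: Ck_SucI[where f'="\<lambda>_ _. 0"] simp del: Ck.simps(2))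

lemma Ck_bounded_linear:
  assumes "bounded_linear f" shows "Ck k f"
proof (cases k)
  case 0
  then show ?thesis using assms by (simp add: linear_continuous_on)
next
  case (Suc j)
  then show ?thesis
    using assms by (auto intro!: Ck_SucI[where f'="\<lambda>_. f"] Ck_const bounded_linear_imp_has_derivative simp del: Ck.simps(2))
qed

lemma Ck_add: "Ck k f \<Longrightarrow> Ck k g \<Longrightarrow> Ck k (\<lambda>x. f x + g x)"
proof (induction k arbitrary: f g)
  case 0
  then show ?case by (auto intro: continuous_intros)
next
  case (Suc k)
  have *: "\<And>x. (f has_derivative frechet_derivative f (at x)) (at x)"
     "\<And>x. (g has_derivative frechet_derivative g (at x)) (at x)"
    using Suc.prems by (simp_all add: frechet_derivative_works)
  show ?case
    by (rule Ck_SucI[where f'="\<lambda>x v. frechet_derivative f (at x) v + frechet_derivative g (at x) v"])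
       (use Suc.prems in \<open>auto intro!: derivative_eq_intros * Suc.IH\<close>)
qed

lemma Ck_bilinear:
  assumes "bounded_bilinear h"
  shows "Ck k f \<Longrightarrow> Ck k g \<Longrightarrow> Ck k (\<lambda>x. h (f x) (g x))"
proof (induction k arbitrary: f g)
  case 0
  then show ?case by (auto intro: bounded_bilinear.continuous_on[OF assms])
next
  case (Suc k)
  have *: "\<And>x. (f has_derivative frechet_derivative f (at x)) (at x)"
     "\<And>x. (g has_derivative frechet_derivative g (at x)) (at x)"
    using Suc.prems by (simp_all add: frechet_derivative_works)
  have l: "Ck k f" "Ck k g" using Suc.prems Ck_lower by blast+
  show ?case
    by (rule Ck_SucI[where f'="\<lambda>x v. h (f x) (frechet_derivative g (at x) v) + h (frechet_derivative f (at x) v) (g x)"])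
       (use Suc.prems in \<open>auto intro!: bounded_bilinear.FDERIV[OF assms] * Suc.IH Ck_add l\<close>)
qed

lemmas Ck_mult = Ck_bilinear[OF bounded_bilinear_mult]
lemma Ck_linear_comp:
  assumes "bounded_linear h" "Ck k f" shows "Ck k (\<lambda>x. h (f x))"
  using assms(2)
proof (induction k arbitrary: f)
  case 0
  then show ?case by (auto intro: bounded_linear.continuous_on[OF assms(1)])
next
  case (Suc k)
  have *: "\<And>x. (f has_derivative frechet_derivative f (at x)) (at x)"
    using Suc.prems by (simp_all add: frechet_derivative_works)
  show ?case
    by (rule Ck_SucI[where f'="\<lambda>x v. h (frechet_derivative f (at x) v)"])
       (use Suc.prems in \<open>auto intro!: bounded_linear.has_derivative[OF assms(1)] * Suc.IH\<close>)
qed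

lemma Ck_id: "Ck k (\<lambda>x. x)"
  by (intro Ck_bounded_linear bounded_linear_ident)

lemma Ck_diff: "Ck k f \<Longrightarrow> Ck k g \<Longrightarrow> Ck k (\<lambda>x. f x - g x)"
  using Ck_add[OF _ Ck_linear_comp[OF bounded_linear_minus[OF bounded_linear_ident]], of k f g] by simp

lemma Ck_SucI_real:
  fixes f :: "real \<Rightarrow> real"
  assumes "\<And>x. (f has_real_derivative f' x) (at x)" "Ck k f'"
  shows "Ck (Suc k) f"
  by (rule Ck_SucI[where f'="\<lambda>x v. f' x * v"])
     (use assms in \<open>auto simp: has_field_derivative_def intro!: Ck_mult Ck_const\<close>)

lemma Ck_Suc_realD:
  fixes f :: "real \<Rightarrow> real"
  assumes "Ck (Suc k) f"
  obtains f' where "\<And>x. (f has_real_derivative f' x) (at x)" "Ck k f'"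
proof
  show "(f has_real_derivative frechet_derivative f (at x) 1) (at x)" for x
  proof -
    have d: "(f has_derivative frechet_derivative f (at x)) (at x)"
      using assms by (simp add: frechet_derivative_works)
    have "frechet_derivative f (at x) v = frechet_derivative f (at x) 1 * v" for v
      using linear_cmul[OF has_derivative_linear[OF d], of v 1] by simp
    then have "frechet_derivative f (at x) = (*) (frechet_derivative f (at x) 1)" by blast
    then show ?thesis using d unfolding has_field_derivative_def by metis
  qed
  show "Ck k (\<lambda>x. frechet_derivative f (at x) 1)" using assms by simp
qed

lemma Ck_compose:
  fixes f :: "real \<Rightarrow> real"
  shows "Ck k f \<Longrightarrow> Ck k g \<Longrightarrow> Ck k (\<lambda>x. f (g x))"
proof (induction k arbitrary: f)
  case 0
  then show ?case by (auto intro: continuous_on_compose2)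
next
  case (Suc k)
  obtain f' where f': "\<And>x. (f has_real_derivative f' x) (at x)" "Ck k f'"
    using Ck_Suc_realD[OF Suc.prems(1)] by blast
  have *: "\<And>x. (g has_derivative frechet_derivative g (at x)) (at x)"
    using Suc.prems by (simp_all add: frechet_derivative_works)
  show ?case
  proof (rule Ck_SucI[where f'="\<lambda>x v. f' (g x) * frechet_derivative g (at x) v"])
    show "((\<lambda>x. f (g x)) has_derivative (\<lambda>v. f' (g x) * frechet_derivative g (at x) v)) (at x)" for x
      using has_derivative_compose[OF * f'(1)[unfolded has_field_derivative_def]] by simp
    have "Ck k (\<lambda>x. f' (g x))"
      by (rule Suc.IH[OF f'(2) Ck_lower[OF Suc.prems(2)]])
    then show "Ck k (\<lambda>x. f' (g x) * frechet_derivative g (at x) v)" for v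
      by (rule Ck_mult) (use Suc.prems in auto)
  qed
qed

lemma DERIV_zero_below:
  fixes u :: "real \<Rightarrow> real"
  assumes "\<And>t. t < e \<Longrightarrow> u t = 0" "t < e"
  shows "(u has_real_derivative 0) (at t)"
proof -
  have "((\<lambda>_. 0) has_real_derivative 0) (at t)" by simp
  then show ?thesis
    by (rule DERIV_cong_ev[THEN iffD1, rotated -1, OF _ refl _ refl])
       (use assms in \<open>auto intro: eventually_mono[OF eventually_nhds_in_open[of "{..<e}"]]\<close>)
qed

section \<open>A smooth step\<close>

text \<open>The powers of \<open>1 / t\<close> are included because the derivatives of \<open>exp (- 1 / t)\<close> are
  combinations of such products, so the whole family is closed under differentiation.\<close>

definition flat_exp :: "nat \<Rightarrow> real \<Rightarrow> real" where
  "flat_exp n t = (if t \<le> 0 then 0 else exp (- inverse t) * inverse t ^ n)"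

lemma flat_exp_tendsto: "((\<lambda>t. exp (- inverse t) * inverse t ^ n) \<longlongrightarrow> 0) (at_right (0::real))"
proof -
  have "((\<lambda>x::real. x ^ n / exp x) \<longlongrightarrow> 0) at_top"
    by (rule tendsto_power_div_exp_0)
  then have "((\<lambda>t::real. inverse t ^ n / exp (inverse t)) \<longlongrightarrow> 0) (at_right 0)"
    using filterlim_compose[OF _ filterlim_inverse_at_top_right] by blast
  then show ?thesis by (simp add: exp_minus field_simps)
qed

lemma flat_exp_deriv:
  "(flat_exp n has_real_derivative flat_exp (n+2) t - n * flat_exp (n+1) t) (at t)"
proof -
  consider "t < 0" | "t > 0" | "t = 0" by linarith
  then show ?thesis
  proof cases
    case 1
    have "(flat_exp n has_real_derivative 0) (at t)"
      by (rule DERIV_zero_below[OF _ 1]) (simp add: flat_exp_def)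
    then show ?thesis using 1 by (simp add: flat_exp_def)
  next
    case 2
    define s where "s = inverse t"
    have i: "(inverse has_real_derivative - (s^2)) (at t)"
      using DERIV_inverse[of t] 2 by (simp add: s_def power2_eq_square)
    have "((\<lambda>t. exp (- inverse t) * inverse t ^ n) has_real_derivative
        exp (- s) * s^2 * s^n + (n * s ^ (n - 1) * - (s^2)) * exp (- s)) (at t)"
      by (rule derivative_eq_intros i refl | simp add: s_def[symmetric])+
    moreover have "exp (- s) * s^2 * s^n + (n * s ^ (n - 1) * - (s^2)) * exp (- s)
      = exp (- s) * s ^ (n+2) - n * (exp (- s) * s ^ (n+1))"
      by (cases n) (simp_all add: power2_eq_square algebra_simps)
    ultimately have "((\<lambda>t. exp (- inverse t) * inverse t ^ n) has_real_derivative
        exp (- inverse t) * inverse t ^ (n+2) - n * (exp (- inverse t) * inverse t ^ (n+1))) (at t)"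
      by (simp add: s_def)
    then have "(flat_exp n has_real_derivative
        exp (- inverse t) * inverse t ^ (n+2) - n * (exp (- inverse t) * inverse t ^ (n+1))) (at t)"
      by (rule DERIV_cong_ev[THEN iffD1, rotated -1, OF _ refl _ refl])
         (use 2 in \<open>auto simp: flat_exp_def intro: eventually_mono[OF eventually_nhds_in_open[of "{0<..}"]]\<close>)
    then show ?thesis using 2 by (simp add: flat_exp_def)
  next
    case 3
    have l: "((\<lambda>h. (flat_exp n h) / h) \<longlongrightarrow> 0) (at_left 0)"
      by (rule tendsto_eventually) (auto simp: flat_exp_def eventually_at_filter)
    have r: "((\<lambda>h. (flat_exp n h) / h) \<longlongrightarrow> 0) (at_right 0)"
      by (rule Lim_transform_eventually[OF flat_exp_tendsto[of "Suc n"]])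
         (auto simp: flat_exp_def eventually_at_filter field_simps)
    have "((\<lambda>h. (flat_exp n (0+h) - flat_exp n 0) / h) \<longlongrightarrow> 0) (at 0)"
      using filterlim_split_at[OF l r] by (simp add: flat_exp_def)
    then show ?thesis using 3 by (simp add: flat_exp_def DERIV_def)
  qed
qed

lemma Ck_flat_exp: "Ck k (flat_exp n)"
proof (induction k arbitrary: n)
  case 0
  then show ?case
    using flat_exp_deriv by (auto intro!: continuous_at_imp_continuous_on DERIV_isCont)
next
  case (Suc k)
  show ?case
    by (rule Ck_SucI_real[OF flat_exp_deriv])
       (use Ck_add[OF Suc Ck_mult[OF Ck_const Suc], of "n+2" "- real n" "n+1"] in simp)
qed

definition bump :: "real \<Rightarrow> real" where
  "bump t = flat_exp 0 t * flat_exp 0 (1 - t)"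

lemma Ck_bump: "Ck k bump"
  unfolding bump_def[abs_def]
  by (rule Ck_mult[OF Ck_flat_exp Ck_compose[OF Ck_flat_exp Ck_diff[OF Ck_const Ck_id]]])

lemma bump_nonneg: "0 \<le> bump t" and bump_le_1: "bump t \<le> 1"
  by (auto simp: bump_def flat_exp_def intro!: mult_le_one)

lemma bump_eq_0: "t \<le> 0 \<or> 1 \<le> t \<Longrightarrow> bump t = 0"
  by (auto simp: bump_def flat_exp_def)

lemma bump_pos: "0 < t \<Longrightarrow> t < 1 \<Longrightarrow> 0 < bump t"
  by (auto simp: bump_def flat_exp_def)

lemma continuous_bump: "continuous_on S bump"
  using Ck_bump[of 0] continuous_on_subset by auto

text \<open>An antiderivative of the bump, constant on each side of the unit interval and with values
  in the unit interval. The base point \<open>- 1\<close> lies to the left of the support, so that the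
  fundamental theorem of calculus also covers the point \<open>0\<close>.\<close>

definition smooth_step :: "real \<Rightarrow> real" where
  "smooth_step t = integral {-1..t} bump"

lemma smooth_step_eq_0: "t \<le> 0 \<Longrightarrow> smooth_step t = 0"
  unfolding smooth_step_def
  by (rule integral_unique, rule has_integral_is_0) (auto simp: bump_eq_0)

lemma smooth_step_deriv: "(smooth_step has_real_derivative bump t) (at t)"
proof (cases "t < 0")
  case True
  have "(smooth_step has_real_derivative 0) (at t)"
    by (rule DERIV_zero_below[OF _ True]) (simp add: smooth_step_eq_0)
  then show ?thesis using True by (simp add: bump_eq_0)
next
  case False
  have "(smooth_step has_real_derivative bump t) (at t within {-1..t+1})"
    unfolding smooth_step_def[abs_def]
    by (rule integral_has_real_derivative) (use False in \<open>auto intro: continuous_bump\<close>)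
  then have "(smooth_step has_real_derivative bump t) (at t within {-1<..<t+1})"
    by (rule DERIV_subset) auto
  then show ?thesis using False at_within_open[of t "{-1<..<t+1}"] by simp
qed

lemma Ck_smooth_step: "Ck k smooth_step"
  by (rule Ck_lower, rule Ck_SucI_real[OF smooth_step_deriv Ck_bump])

lemma smooth_step_nonneg: "0 \<le> smooth_step t"
  unfolding smooth_step_def by (intro integral_nonneg integrable_continuous_interval continuous_bump bump_nonneg)

lemma smooth_step_const: assumes "1 \<le> t" shows "smooth_step t = smooth_step 1"
proof -
  have "integral {-1..1} bump + integral {1..t} bump = integral {-1..t} bump"
    by (rule Henstock_Kurzweil_Integration.integral_combine)
       (use assms in \<open>auto intro!: integrable_continuous_interval continuous_bump\<close>)
  moreover have "integral {1..t} bump = 0"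
    by (rule integral_unique, rule has_integral_is_0) (auto simp: bump_eq_0)
  ultimately show ?thesis by (simp add: smooth_step_def)
qed

lemma smooth_step_le_1: "smooth_step t \<le> 1"
proof -
  have *: "smooth_step s \<le> smooth_step u" if "s \<le> u" for s u
    by (rule DERIV_nonneg_imp_nondecreasing[OF that]) (use smooth_step_deriv bump_nonneg in blast)
  have "smooth_step 1 - smooth_step 0 \<le> 1"
  proof -
    obtain z where "smooth_step 1 - smooth_step 0 = (1 - 0) * bump z"
      using MVT2[of 0 1 smooth_step bump] smooth_step_deriv by auto
    then show ?thesis using bump_le_1[of z] by simp
  qed
  moreover have "smooth_step t \<le> smooth_step 1"
    using *[of t 1] smooth_step_const[of t] by linarith
  ultimately show ?thesis by (simp add: smooth_step_eq_0)
qed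

section \<open>Bicomplex multiplication\<close>

text \<open>In idempotent components multiplication is componentwise, so the norm is a multiple of the
  Euclidean norm of \<open>\<complex>\<^sup>2\<close> with its product-ring structure; the factor \<open>sqrt 2\<close> comes from the
  normalisation of that norm.\<close>

lemma bounded_bilinear_bc_mult: "bounded_bilinear ((*) :: bicomplex \<Rightarrow> bicomplex \<Rightarrow> bicomplex)"
  and norm_bc_mult_le: "norm (v * u :: bicomplex) \<le> sqrt 2 * norm v * norm u"
proof -
  have pm: "bc_plus (v * u) = bc_plus v * bc_plus u" "bc_minus (v * u) = bc_minus v * bc_minus u" for v u
    by (simp_all add: bc_plus_def bc_minus_def times_bicomplex_def algebra_simps)
  have *: "norm (v * u) \<le> sqrt 2 * norm v * norm u" for v u :: bicomplex
  proof -
    define a b c d where "a = (cmod (bc_plus v))\<^sup>2" "b = (cmod (bc_minus v))\<^sup>2"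
      "c = (cmod (bc_plus u))\<^sup>2" "d = (cmod (bc_minus u))\<^sup>2"
    have nn: "0 \<le> a" "0 \<le> b" "0 \<le> c" "0 \<le> d" by (simp_all add: a_b_c_d_def)
    have "a * c + b * d \<le> (a + b) * (c + d)"
      using nn by (simp add: algebra_simps)
    then have "sqrt ((a * c + b * d) / 2) \<le> sqrt (2 * ((a + b) / 2) * ((c + d) / 2))"
      by (intro real_sqrt_le_mono) (simp add: field_simps)
    then show ?thesis
      by (simp add: norm_bicomplex_def pm norm_mult power_mult_distrib real_sqrt_mult[symmetric] a_b_c_d_def)
  qed
  then show "norm (v * u :: bicomplex) \<le> sqrt 2 * norm v * norm u" .
  show "bounded_bilinear ((*) :: bicomplex \<Rightarrow> bicomplex \<Rightarrow> bicomplex)"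
  proof
    show "\<exists>K. \<forall>a b :: bicomplex. norm (a * b) \<le> norm a * norm b * K"
      by (rule exI[of _ "sqrt 2"]) (use * in \<open>simp add: mult_ac\<close>)
  qed (simp_all add: algebra_simps bicomplex_eq_iff times_bicomplex_def scaleR_bicomplex_def
         plus_bicomplex_def)
qed

lemmas bc_mult_scaleR_right = bounded_bilinear.scaleR_right[OF bounded_bilinear_bc_mult]

text \<open>\<open>bc_cnj (x + i y) = x - j y\<close>. Divided by \<open>|\<zeta>|\<^sup>2\<close> this is the inverse of \<open>x + j y\<close>, hence
  the Cauchy kernel of the bicomplex d-bar operator.\<close>

definition bc_cnj :: "complex \<Rightarrow> bicomplex" where
  "bc_cnj \<zeta> = Bicomplex (complex_of_real (Re \<zeta>)) (- complex_of_real (Im \<zeta>))"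

text \<open>The idempotent components of \<open>x - j y\<close> are \<open>\<zeta>\<close> and its conjugate, of equal modulus.\<close>

lemma norm_mult_bc_cnj: "norm (v * bc_cnj \<zeta>) = cmod \<zeta> * norm v"
proof -
  have p: "bc_plus (v * bc_cnj \<zeta>) = bc_plus v * \<zeta>"
    by (simp add: bc_plus_def bc_cnj_def times_bicomplex_def complex_eq_iff algebra_simps)
  have m: "bc_minus (v * bc_cnj \<zeta>) = bc_minus v * cnj \<zeta>"
    by (simp add: bc_minus_def bc_cnj_def times_bicomplex_def complex_eq_iff algebra_simps)
  have "norm (v * bc_cnj \<zeta>) = sqrt ((cmod \<zeta>)\<^sup>2 * (((cmod (bc_plus v))\<^sup>2 + (cmod (bc_minus v))\<^sup>2) / 2))"
    unfolding norm_bicomplex_def p m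
    by (rule arg_cong[where f=sqrt]) (simp add: norm_mult power_mult_distrib field_simps)
  then show ?thesis by (simp only: norm_bicomplex_def real_sqrt_mult real_sqrt_abs abs_norm_cancel)
qed

lemma continuous_on_bc_of_complex [continuous_intros]:
  "continuous_on S f \<Longrightarrow> continuous_on S (\<lambda>x. bc_of_complex (f x))"
proof -
  have "bounded_linear bc_of_complex"
    by standard (auto simp: bc_of_complex_def plus_bicomplex_def scaleR_bicomplex_def norm_bicomplex_def
         bc_plus_def bc_minus_def intro!: exI[of _ 1])
  then show "continuous_on S f \<Longrightarrow> continuous_on S (\<lambda>x. bc_of_complex (f x))"
    by (rule bounded_linear.continuous_on)
qed

lemma continuous_on_bc_mult [continuous_intros]:
  "continuous_on S f \<Longrightarrow> continuous_on S g \<Longrightarrow> continuous_on S (\<lambda>x. f x * g x :: bicomplex)"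
  by (rule bounded_bilinear.continuous_on[OF bounded_bilinear_bc_mult])

lemma borel_measurable_bc_mult [measurable (raw)]:
  "f \<in> borel_measurable M \<Longrightarrow> g \<in> borel_measurable M \<Longrightarrow> (\<lambda>x. f x * g x :: bicomplex) \<in> borel_measurable M"
  by (rule borel_measurable_continuous_Pair) (auto intro!: continuous_intros)

lemma lebesgue_measurable_continuous:
  fixes b :: "complex \<Rightarrow> 'a::topological_space"
  assumes "continuous_on UNIV b" shows "b \<in> borel_measurable lebesgue"
  using borel_measurable_continuous_onI[OF assms] by (simp add: measurable_completion)

section \<open>Testing the weak equation against a Cauchy kernel\<close>

text \<open>Test functions vanish off a compact subset of \<open>S\<close>, where \<open>g\<close> is integrable; thus the
  integrals in the weak equation converge absolutely, may be split linearly, and may be taken over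
  the whole plane.\<close>

lemma locally_integrable_mult:
  assumes "locally_integrable_on S g" "compact K" "K \<subseteq> S" "S \<in> sets lebesgue"
    and b: "continuous_on UNIV b" "\<And>\<zeta>. \<zeta> \<notin> K \<Longrightarrow> b \<zeta> = 0"
  shows "integrable lebesgue (\<lambda>\<zeta>. g \<zeta> * b \<zeta>)"
    and "integral\<^sup>L (lebesgue_on S) (\<lambda>\<zeta>. g \<zeta> * b \<zeta>) = integral\<^sup>L lebesgue (\<lambda>\<zeta>. g \<zeta> * b \<zeta>)"
proof -
  have Kl: "K \<in> sets lebesgue" using assms(2) by (simp add: compact_imp_closed lebesgue_closedin borel_closed)
  have gK: "integrable lebesgue (\<lambda>\<zeta>. indicator K \<zeta> *\<^sub>R g \<zeta>)"
    using assms(1-3) Kl by (auto simp: locally_integrable_on_def integrable_restrict_space)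
  have "compact (b ` K)"
    using b(1) assms(2) by (auto intro: compact_continuous_image continuous_on_subset)
  then obtain B where B: "\<And>\<zeta>. \<zeta> \<in> K \<Longrightarrow> norm (b \<zeta>) \<le> B"
    using compact_imp_bounded[of "b ` K"] by (auto simp: bounded_iff)
  have bm: "b \<in> borel_measurable lebesgue" by (rule lebesgue_measurable_continuous[OF b(1)])
  have eq: "g \<zeta> * b \<zeta> = (indicator K \<zeta> *\<^sub>R g \<zeta>) * b \<zeta>" for \<zeta>
    using b(2)[of \<zeta>] by (auto simp: indicator_def)
  show "integrable lebesgue (\<lambda>\<zeta>. g \<zeta> * b \<zeta>)"
  proof (rule Bochner_Integration.integrable_bound)
    show "integrable lebesgue (\<lambda>\<zeta>. (sqrt 2 * B) *\<^sub>R (indicator K \<zeta> *\<^sub>R g \<zeta>))"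
      using gK by (rule integrable_scaleR_right)
    show "(\<lambda>\<zeta>. g \<zeta> * b \<zeta>) \<in> borel_measurable lebesgue"
      unfolding eq using gK bm by (intro borel_measurable_bc_mult) auto
    show "AE \<zeta> in lebesgue. norm (g \<zeta> * b \<zeta>) \<le> norm ((sqrt 2 * B) *\<^sub>R (indicator K \<zeta> *\<^sub>R g \<zeta>))"
    proof (intro AE_I2)
      fix \<zeta>
      show "norm (g \<zeta> * b \<zeta>) \<le> norm ((sqrt 2 * B) *\<^sub>R (indicator K \<zeta> *\<^sub>R g \<zeta>))"
      proof (cases "\<zeta> \<in> K")
        case True
        then have "sqrt 2 * norm (g \<zeta>) * norm (b \<zeta>) \<le> sqrt 2 * norm (g \<zeta>) * \<bar>B\<bar>"
          using B[of \<zeta>] by (intro mult_left_mono) auto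
        then show ?thesis using norm_bc_mult_le[of "g \<zeta>" "b \<zeta>"] True
          by (simp add: abs_mult mult_ac)
      qed (simp add: b(2))
    qed
  qed
  have "indicator S \<zeta> *\<^sub>R (g \<zeta> * b \<zeta>) = g \<zeta> * b \<zeta>" for \<zeta>
  proof (cases "\<zeta> \<in> S")
    case False
    then have "b \<zeta> = 0" using b(2) assms(3) by blast
    then show ?thesis by simp
  qed simp
  then show "integral\<^sup>L (lebesgue_on S) (\<lambda>\<zeta>. g \<zeta> * b \<zeta>) = integral\<^sup>L lebesgue (\<lambda>\<zeta>. g \<zeta> * b \<zeta>)"
    using assms(4) by (simp add: integral_restrict_space)
qed

text \<open>The bicomplex test function is
  \<open>k(|\<zeta> - z|\<^sup>2) (x - j y)\<close> with \<open>x + i y = \<zeta> - z\<close>. Its d-bar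
  derivative is the real number \<open>(t k(t))'\<close> at \<open>t = |\<zeta> - z|\<^sup>2\<close>, just as
  \<open>\<partial>/\<partial>\<zeta>\<^sup>* (\<zeta>\<^sup>* k(\<zeta> \<zeta>\<^sup>*)) = k + t k'\<close> in the complex case. Test functions are complex valued, so the two
  real components are tested separately and combined with the coefficients \<open>1\<close> and \<open>- j\<close>.\<close>

lemma weak_dbar_radial:
  fixes z :: complex and k k' :: "real \<Rightarrow> real" and r :: real
  assumes dbar: "has_weak_dbar S f g" and S: "S \<in> sets lebesgue" and sub: "cball z r \<subseteq> S"
    and r: "0 \<le> r"
    and k: "\<And>n. Ck n k" "\<And>t. (k has_real_derivative k' t) (at t)" "\<And>t. r\<^sup>2 \<le> t \<Longrightarrow> k t = 0"
  defines "T \<equiv> \<lambda>\<zeta>. (cmod (\<zeta> - z))\<^sup>2"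
  shows "integral\<^sup>L lebesgue (\<lambda>\<zeta>. (k (T \<zeta>) + T \<zeta> * k' (T \<zeta>)) *\<^sub>R f \<zeta>)
       = - integral\<^sup>L lebesgue (\<lambda>\<zeta>. g \<zeta> * (k (T \<zeta>) *\<^sub>R bc_cnj (\<zeta> - z)))"
proof -
  have T_eq: "T \<zeta> = (Re \<zeta> - Re z) * (Re \<zeta> - Re z) + (Im \<zeta> - Im z) * (Im \<zeta> - Im z)" for \<zeta>
    unfolding T_def cmod_power2 by (simp add: power2_eq_square)
  have CkRI: "Ck n (\<lambda>\<zeta>. Re \<zeta> - Re z)" "Ck n (\<lambda>\<zeta>. Im \<zeta> - Im z)" for n
    by (intro Ck_diff Ck_bounded_linear Ck_const bounded_linear_Re bounded_linear_Im)+
  have "Ck n T" for n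
    unfolding T_eq[abs_def] by (intro Ck_add Ck_mult CkRI)
  then have CkkT: "Ck n (\<lambda>\<zeta>. k (T \<zeta>))" for n
    by (rule Ck_compose[OF k(1)])
  define \<phi> where "\<phi> l \<zeta> = complex_of_real (l (\<zeta> - z) * k (T \<zeta>))" for l :: "complex \<Rightarrow> real" and \<zeta>
  have Ck\<phi>: "Ck n (\<phi> Re)" "Ck n (\<phi> Im)" for n
    unfolding \<phi>_def by (intro Ck_linear_comp[OF bounded_linear_of_real] Ck_mult CkkT; use CkRI[of n] in simp)+
  have kT0: "k (T \<zeta>) = 0" if "\<zeta> \<notin> cball z r" for \<zeta>
    using that r by (intro k(3)) (auto simp: T_def dist_norm norm_minus_commute intro!: power_mono)
  have supp: "closure {\<zeta>. \<phi> l \<zeta> \<noteq> 0} \<subseteq> cball z r" for l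
  proof (rule closure_minimal)
    show "{\<zeta>. \<phi> l \<zeta> \<noteq> 0} \<subseteq> cball z r"
      using kT0 unfolding \<phi>_def by fastforce
  qed simp
  have test: "test_function_on S (\<phi> Re)" "test_function_on S (\<phi> Im)"
    using Ck\<phi> supp sub compact_closure bounded_subset[OF bounded_cball] closure_subset
    unfolding test_function_on_def by (meson order_trans)+
  have deriv: "frechet_derivative (\<phi> l) (at \<zeta>) v = 
      complex_of_real (l v * k (T \<zeta>) + l (\<zeta> - z) * (k' (T \<zeta>) * (2 * Re (\<zeta> - z) * Re v + 2 * Im (\<zeta> - z) * Im v)))"
    if l: "bounded_linear l" for l \<zeta> v
  proof -
    have T': "(T has_derivative (\<lambda>v. 2 * Re (\<zeta> - z) * Re v + 2 * Im (\<zeta> - z) * Im v)) (at \<zeta>)"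
      unfolding T_eq[abs_def] by (auto intro!: derivative_eq_intros simp: fun_eq_iff algebra_simps)
    have k'': "((\<lambda>\<zeta>. k (T \<zeta>)) has_derivative (\<lambda>v. k' (T \<zeta>) * (2 * Re (\<zeta> - z) * Re v + 2 * Im (\<zeta> - z) * Im v))) (at \<zeta>)"
      using has_derivative_compose[OF T' k(2)[unfolded has_field_derivative_def]] .
    have l': "((\<lambda>\<zeta>. l (\<zeta> - z)) has_derivative l) (at \<zeta>)"
      by (rule has_derivative_eq_rhs[OF bounded_linear.has_derivative[OF l]]) (auto intro!: derivative_eq_intros)
    have "(\<phi> l has_derivative (\<lambda>v. complex_of_real (l (\<zeta> - z) * (k' (T \<zeta>) * (2 * Re (\<zeta> - z) * Re v + 2 * Im (\<zeta> - z) * Im v)) + l v * k (T \<zeta>)))) (at \<zeta>)"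
      unfolding \<phi>_def[abs_def]
      by (rule bounded_linear.has_derivative[OF bounded_linear_of_real has_derivative_mult[OF l' k'']])
    then show ?thesis by (simp add: frechet_derivative_at[symmetric] add.commute)
  qed
  have D: "bc_dbar (\<phi> Re) \<zeta> - bc_j * bc_dbar (\<phi> Im) \<zeta> = (k (T \<zeta>) + T \<zeta> * k' (T \<zeta>)) *\<^sub>R 1" for \<zeta>
    by (simp add: bc_dbar_def deriv[OF bounded_linear_Re] deriv[OF bounded_linear_Im] bicomplex_eq_iff
        bc_of_complex_def bc_j_def times_bicomplex_def scaleR_bicomplex_def plus_bicomplex_def minus_bicomplex_def
        one_bicomplex_def complex_eq_iff T_eq algebra_simps)
  have C: "bc_of_complex (\<phi> Re \<zeta>) - bc_j * bc_of_complex (\<phi> Im \<zeta>) = k (T \<zeta>) *\<^sub>R bc_cnj (\<zeta> - z)" for \<zeta>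
    by (simp add: \<phi>_def bicomplex_eq_iff bc_cnj_def bc_of_complex_def bc_j_def times_bicomplex_def 
        scaleR_bicomplex_def minus_bicomplex_def complex_eq_iff algebra_simps)
  have cont: "continuous_on UNIV (\<phi> l)" "continuous_on UNIV (\<lambda>\<zeta>. frechet_derivative (\<phi> l) (at \<zeta>) v)"
    if "l = Re \<or> l = Im" for l v
    using Ck\<phi>[of 0] Ck\<phi>[of 1] that by auto
  have contd: "continuous_on UNIV (bc_dbar (\<phi> l))" if "l = Re \<or> l = Im" for l
    unfolding bc_dbar_def[abs_def] by (intro continuous_intros cont that)
  have zero: "\<phi> l \<zeta> = 0" "bc_dbar (\<phi> l) \<zeta> = 0" if "l = Re \<or> l = Im" "\<zeta> \<notin> cball z r" for l \<zeta>
  proof -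
    show "\<phi> l \<zeta> = 0" using kT0[OF that(2)] by (simp add: \<phi>_def)
    have "(\<phi> l has_derivative (\<lambda>_. 0)) (at \<zeta>)"
      by (rule has_derivative_transform_within_open[of "\<lambda>_. 0" _ _ _ "- cball z r"])
         (use that(2) kT0 in \<open>auto simp: \<phi>_def open_Compl\<close>)
    then have "frechet_derivative (\<phi> l) (at \<zeta>) = (\<lambda>_. 0)" by (simp add: frechet_derivative_at[symmetric])
    then show "bc_dbar (\<phi> l) \<zeta> = 0"
      by (simp add: bc_dbar_def bc_of_complex_def zero_bicomplex_def[symmetric])
  qed
  have loc: "locally_integrable_on S f" "locally_integrable_on S g"
    using dbar by (auto simp: has_weak_dbar_def)
  note lm = locally_integrable_mult[OF _ compact_cball sub S]
  have eq: "integral\<^sup>L lebesgue (\<lambda>\<zeta>. f \<zeta> * bc_dbar (\<phi> l) \<zeta>) = - integral\<^sup>L lebesgue (\<lambda>\<zeta>. g \<zeta> * bc_of_complex (\<phi> l \<zeta>))"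
    and int: "integrable lebesgue (\<lambda>\<zeta>. f \<zeta> * bc_dbar (\<phi> l) \<zeta>)" "integrable lebesgue (\<lambda>\<zeta>. g \<zeta> * bc_of_complex (\<phi> l \<zeta>))"
    if l: "l = Re \<or> l = Im" for l
  proof -
    have z: "bc_of_complex (\<phi> l \<zeta>) = 0" if "\<zeta> \<notin> cball z r" for \<zeta>
      using zero(1)[OF l that] by (simp add: bc_of_complex_def zero_bicomplex_def)
    note a = lm[OF loc(1) contd[OF l] zero(2)[OF l]]
      and b = lm[OF loc(2) continuous_on_bc_of_complex[OF cont(1)[OF l]] z]
    show "integrable lebesgue (\<lambda>\<zeta>. f \<zeta> * bc_dbar (\<phi> l) \<zeta>)" "integrable lebesgue (\<lambda>\<zeta>. g \<zeta> * bc_of_complex (\<phi> l \<zeta>))"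
      using a b by simp_all
    show "integral\<^sup>L lebesgue (\<lambda>\<zeta>. f \<zeta> * bc_dbar (\<phi> l) \<zeta>) = - integral\<^sup>L lebesgue (\<lambda>\<zeta>. g \<zeta> * bc_of_complex (\<phi> l \<zeta>))"
      using a(2) b(2) dbar test l by (auto simp: has_weak_dbar_def)
  qed
  have bl: "bounded_linear ((*) bc_j)"
    by (rule bounded_bilinear.bounded_linear_right[OF bounded_bilinear_bc_mult])
  have lin: "integral\<^sup>L lebesgue (\<lambda>\<zeta>. h \<zeta> * (a \<zeta> - bc_j * b \<zeta>))
      = integral\<^sup>L lebesgue (\<lambda>\<zeta>. h \<zeta> * a \<zeta>) - bc_j * integral\<^sup>L lebesgue (\<lambda>\<zeta>. h \<zeta> * b \<zeta>)"
    if "integrable lebesgue (\<lambda>\<zeta>. h \<zeta> * a \<zeta>)" "integrable lebesgue (\<lambda>\<zeta>. h \<zeta> * b \<zeta>)" for h a b :: "complex \<Rightarrow> bicomplex"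
  proof -
    have "integral\<^sup>L lebesgue (\<lambda>\<zeta>. h \<zeta> * (a \<zeta> - bc_j * b \<zeta>))
      = integral\<^sup>L lebesgue (\<lambda>\<zeta>. h \<zeta> * a \<zeta> - bc_j * (h \<zeta> * b \<zeta>))"
      by (simp add: algebra_simps)
    also have "\<dots> = integral\<^sup>L lebesgue (\<lambda>\<zeta>. h \<zeta> * a \<zeta>) - integral\<^sup>L lebesgue (\<lambda>\<zeta>. bc_j * (h \<zeta> * b \<zeta>))"
      by (intro Bochner_Integration.integral_diff that integrable_bounded_linear[OF bl])
    finally show ?thesis by (simp add: integral_bounded_linear[OF bl that(2)])
  qed
  have "integral\<^sup>L lebesgue (\<lambda>\<zeta>. (k (T \<zeta>) + T \<zeta> * k' (T \<zeta>)) *\<^sub>R f \<zeta>)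
      = integral\<^sup>L lebesgue (\<lambda>\<zeta>. f \<zeta> * (bc_dbar (\<phi> Re) \<zeta> - bc_j * bc_dbar (\<phi> Im) \<zeta>))"
    by (simp add: D bc_mult_scaleR_right)
  also have "\<dots> = - integral\<^sup>L lebesgue (\<lambda>\<zeta>. g \<zeta> * (bc_of_complex (\<phi> Re \<zeta>) - bc_j * bc_of_complex (\<phi> Im \<zeta>)))"
    using eq[of Re] eq[of Im] int[of Re] int[of Im] by (simp add: lin)
  finally show ?thesis by (simp add: C)
qed

text \<open>A function that vanishes near \<open>0\<close> can be divided by powers of \<open>t\<close> without losing smoothness;
  the convention \<open>inverse 0 = 0\<close> makes the quotient correct at \<open>0\<close>.\<close>

lemma DERIV_divide_power:
  fixes u u' :: "real \<Rightarrow> real"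
  assumes "0 < e" "(u has_real_derivative u' t) (at t)" "\<And>t. t < e \<Longrightarrow> u t = 0"
  shows "((\<lambda>t. u t * inverse t ^ m) has_real_derivative
     (u' t * inverse t ^ m - m * (u t * inverse t ^ (m + 1)))) (at t)"
proof (cases "t < e")
  case True
  have "u' t = 0"
    using DERIV_zero_below[of e u, OF assms(3) True] assms(2) DERIV_unique by blast
  then show ?thesis
    using DERIV_zero_below[of e "\<lambda>t. u t * inverse t ^ m", OF _ True] assms(3) True by simp
next
  case False
  then have i: "(inverse has_real_derivative - (inverse t ^ 2)) (at t)"
    using DERIV_inverse[of t] assms(1) by (simp add: power2_eq_square)
  have "((\<lambda>t. u t * inverse t ^ m) has_real_derivative
     u' t * inverse t ^ m + (m * inverse t ^ (m - 1) * - (inverse t ^ 2)) * u t) (at t)"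
    by (rule derivative_eq_intros i assms(2) refl | simp)+
  moreover have "u' t * inverse t ^ m + (m * inverse t ^ (m - 1) * - (inverse t ^ 2)) * u t
      = u' t * inverse t ^ m - m * (u t * inverse t ^ (m + 1))"
    by (cases m) (simp_all add: power2_eq_square algebra_simps)
  ultimately show ?thesis by (simp only:)
qed

text \<open>All powers \<open>m\<close> are needed at once: differentiating \<open>u / t\<^sup>m\<close> produces \<open>u / t\<^sup>m\<^sup>+\<^sup>1\<close>.\<close>

lemma Ck_divide_power:
  fixes u :: "real \<Rightarrow> real"
  assumes "0 < e"
  shows "Ck n u \<Longrightarrow> (\<And>t. t < e \<Longrightarrow> u t = 0) \<Longrightarrow> Ck n (\<lambda>t. u t * inverse t ^ m)"
proof (induction n arbitrary: u m)
  case 0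
  have "isCont (\<lambda>t. u t * inverse t ^ m) t" for t
  proof (cases "t < e")
    case True
    then show ?thesis
      using DERIV_zero_below[of e "\<lambda>t. u t * inverse t ^ m" t] 0(2) DERIV_isCont by simp
  next
    case False
    have "isCont u t" using 0(1) by (simp add: continuous_on_eq_continuous_at)
    then show ?thesis using False assms by (intro continuous_intros) auto
  qed
  then show ?case by (simp add: continuous_at_imp_continuous_on)
next
  case (Suc n)
  obtain u' where u': "\<And>x. (u has_real_derivative u' x) (at x)" "Ck n u'"
    using Ck_Suc_realD[OF Suc.prems(1)] by blast
  have u'0: "u' t = 0" if "t < e" for t
    using DERIV_zero_below[of e u, OF Suc.prems(2) that] u'(1) DERIV_unique by blast
  show ?case
  proof (rule Ck_SucI_real)
    show "((\<lambda>t. u t * inverse t ^ m) has_real_derivative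
       (u' t * inverse t ^ m - m * (u t * inverse t ^ (m + 1)))) (at t)" for t
      using DERIV_divide_power[OF assms u'(1) Suc.prems(2)] .
    show "Ck n (\<lambda>t. u' t * inverse t ^ m - m * (u t * inverse t ^ (m + 1)))"
      by (rule Ck_diff[OF Suc.IH[OF u'(2) u'0] Ck_mult[OF Ck_const Suc.IH[OF Ck_lower[OF Suc.prems(1)] Suc.prems(2)]]])
  qed
qed

text \<open>The choice \<open>k(t) = u(t) / t\<close> makes the test function a Cauchy kernel truncated by \<open>u\<close>, and
  \<open>(t k)' = u'\<close>. The truncation is a difference of steps at the scales \<open>a\<close> and \<open>b\<close>, so it cuts off
  both the singularity and the exterior of the disk, and \<open>u'\<close> is the difference of two bumps
  living on annuli of radius about \<open>sqrt a\<close> and \<open>sqrt b\<close>. The identity compares the averages of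
  \<open>f\<close> over these two annuli.\<close>

lemma weak_dbar_two_scales:
  fixes z :: complex and a b r :: real
  assumes dbar: "has_weak_dbar S f g" and S: "S \<in> sets lebesgue" and sub: "cball z r \<subseteq> S"
    and ab: "0 < a" "a \<le> b" "2 * b \<le> r\<^sup>2" "0 \<le> r"
  defines "T \<equiv> \<lambda>\<zeta>. (cmod (\<zeta> - z))\<^sup>2"
  obtains k where "\<And>\<zeta>. norm (g \<zeta> * (k (T \<zeta>) *\<^sub>R bc_cnj (\<zeta> - z))) \<le> norm (g \<zeta>) / cmod (\<zeta> - z) * indicator (ball z r) \<zeta>"
    and "integral\<^sup>L lebesgue (\<lambda>\<zeta>. (bump (T \<zeta> / a - 1) / a - bump (T \<zeta> / b - 1) / b) *\<^sub>R f \<zeta>)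
       = - integral\<^sup>L lebesgue (\<lambda>\<zeta>. g \<zeta> * (k (T \<zeta>) *\<^sub>R bc_cnj (\<zeta> - z)))"
proof
  define u where "u t = smooth_step (t / a - 1) - smooth_step (t / b - 1)" for t
  define u' where "u' t = bump (t / a - 1) / a - bump (t / b - 1) / b" for t
  define k where "k t = u t * inverse t ^ 1" for t
  define k' where "k' t = u' t * inverse t ^ 1 - real 1 * (u t * inverse t ^ (1 + 1))" for t
  have Cu: "Ck n u" for n
  proof -
    have "Ck n (\<lambda>t. smooth_step (t / c - 1))" for c
      by (rule Ck_compose[OF Ck_smooth_step], rule Ck_diff[OF _ Ck_const])
         (rule Ck_bounded_linear[OF bounded_linear_divide])
    then show ?thesis unfolding u_def[abs_def] by (intro Ck_diff)
  qed
  have D: "((\<lambda>t. smooth_step (t / c - 1)) has_real_derivative bump (t / c - 1) / c) (at t)" for c t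
  proof -
    have "((\<lambda>t. t / c - 1) has_real_derivative 1 / c) (at t)"
      by (cases "c = 0") (auto intro!: derivative_eq_intros)
    from DERIV_chain2[OF smooth_step_deriv this] show ?thesis by simp
  qed
  have u': "(u has_real_derivative u' t) (at t)" for t
    unfolding u_def[abs_def] u'_def
    by (intro DERIV_diff D)
  have u0: "u t = 0" if "t < a" for t
  proof -
    have "t \<le> b" "0 < b" using that ab by linarith+
    then have "t / a - 1 \<le> 0" "t / b - 1 \<le> 0" using that ab(1) by (simp_all add: field_simps)
    then show ?thesis by (simp add: u_def smooth_step_eq_0)
  qed
  have u1: "u t = 0" if "r\<^sup>2 \<le> t" for t
  proof -
    have "2 * a \<le> t" "2 * b \<le> t" "0 < b" using that ab by linarith+
    then have "1 \<le> t / a - 1" "1 \<le> t / b - 1" using ab(1) by (simp_all add: field_simps)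
    then have "smooth_step (t / a - 1) = smooth_step 1" "smooth_step (t / b - 1) = smooth_step 1"
      using smooth_step_const by blast+
    then show ?thesis by (simp add: u_def)
  qed
  have uabs: "\<bar>u t\<bar> \<le> 1" for t
    using smooth_step_nonneg[of "t/a-1"] smooth_step_nonneg[of "t/b-1"]
      smooth_step_le_1[of "t/a-1"] smooth_step_le_1[of "t/b-1"] by (simp add: u_def)
  have Ckk: "Ck n k" for n
    unfolding k_def[abs_def] by (rule Ck_divide_power[OF ab(1) Cu u0])
  have k0: "\<And>t. r\<^sup>2 \<le> t \<Longrightarrow> k t = 0" by (simp add: k_def u1)
  have "integral\<^sup>L lebesgue (\<lambda>\<zeta>. (k (T \<zeta>) + T \<zeta> * k' (T \<zeta>)) *\<^sub>R f \<zeta>)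
       = - integral\<^sup>L lebesgue (\<lambda>\<zeta>. g \<zeta> * (k (T \<zeta>) *\<^sub>R bc_cnj (\<zeta> - z)))"
    unfolding T_def
  proof (rule weak_dbar_radial[OF dbar S sub ab(4) Ckk _ k0])
    show "(k has_real_derivative k' t) (at t)" for t
      unfolding k_def[abs_def] k'_def by (rule DERIV_divide_power[OF ab(1) u' u0])
  qed
  moreover have "k t + t * k' t = u' t" for t
  proof (cases "t = 0")
    case True
    have "u' 0 = 0" using DERIV_zero_below[of a u 0, OF u0] ab u' DERIV_unique by blast
    then show ?thesis using True u0[of 0] ab by (simp add: k_def)
  qed (simp add: k_def k'_def field_simps)
  ultimately show "integral\<^sup>L lebesgue (\<lambda>\<zeta>. (bump (T \<zeta> / a - 1) / a - bump (T \<zeta> / b - 1) / b) *\<^sub>R f \<zeta>)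
       = - integral\<^sup>L lebesgue (\<lambda>\<zeta>. g \<zeta> * (k (T \<zeta>) *\<^sub>R bc_cnj (\<zeta> - z)))"
    by (simp add: u'_def)
  show "norm (g \<zeta> * (k (T \<zeta>) *\<^sub>R bc_cnj (\<zeta> - z))) \<le> norm (g \<zeta>) / cmod (\<zeta> - z) * indicator (ball z r) \<zeta>" for \<zeta>
  proof (cases "\<zeta> \<in> ball z r")
    case True
    have "norm (g \<zeta> * (k (T \<zeta>) *\<^sub>R bc_cnj (\<zeta> - z))) = \<bar>k (T \<zeta>)\<bar> * cmod (\<zeta> - z) * norm (g \<zeta>)"
      by (simp add: bc_mult_scaleR_right norm_mult_bc_cnj)
    also have "\<bar>k (T \<zeta>)\<bar> * cmod (\<zeta> - z) = \<bar>u (T \<zeta>)\<bar> / cmod (\<zeta> - z)"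
      by (simp add: k_def T_def abs_mult power2_eq_square field_simps)
    also have "\<dots> * norm (g \<zeta>) \<le> 1 / cmod (\<zeta> - z) * norm (g \<zeta>)"
      by (intro mult_right_mono divide_right_mono uabs) auto
    finally show ?thesis using True by simp
  next
    case False
    then have "r\<^sup>2 \<le> T \<zeta>"
      using ab(4) by (auto simp: T_def dist_norm norm_minus_commute intro!: power_mono)
    then show ?thesis by (simp add: k0)
  qed
qed

section \<open>The Cauchy-Pompeiu inequality\<close>

definition bump_mass :: real where
  "bump_mass = (\<integral>\<zeta>. bump ((cmod \<zeta>)\<^sup>2 - 1) \<partial>lebesgue)"

lemma integrable_lebesgue_compact_support:
  fixes h :: "complex \<Rightarrow> 'a::euclidean_space"
  assumes "continuous_on UNIV h" "compact K" "\<And>\<zeta>. \<zeta> \<notin> K \<Longrightarrow> h \<zeta> = 0"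
  shows "integrable lborel h" "integrable lebesgue h"
proof -
  have "integrable lborel (\<lambda>\<zeta>. indicator K \<zeta> *\<^sub>R h \<zeta>)"
    using assms(1,2) continuous_on_subset by (intro borel_integrable_compact) auto
  moreover have "(\<lambda>\<zeta>. indicator K \<zeta> *\<^sub>R h \<zeta>) = h"
    using assms(3) by (auto simp: indicator_def fun_eq_iff)
  ultimately show "integrable lborel h" by simp
  then show "integrable lebesgue h" by (simp add: integrable_completion)
qed

lemma continuous_radial_bump:
  "continuous_on S (\<lambda>\<zeta>. bump ((cmod (\<zeta> - z))\<^sup>2 / a - 1) / a)"
  unfolding divide_inverse
  by (intro continuous_intros continuous_on_compose2[OF continuous_bump[of UNIV]]) auto

lemma radial_bump_eq_0:
  assumes "0 < a" "2 * a \<le> r\<^sup>2" "0 \<le> r" "\<zeta> \<notin> ball z r"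
  shows "bump ((cmod (\<zeta> - z))\<^sup>2 / a - 1) = 0"
proof -
  have "r\<^sup>2 \<le> (cmod (\<zeta> - z))\<^sup>2"
    using assms by (auto simp: dist_norm norm_minus_commute intro!: power_mono)
  then have "2 * a \<le> (cmod (\<zeta> - z))\<^sup>2" using assms(2) by linarith
  then have "1 \<le> (cmod (\<zeta> - z))\<^sup>2 / a - 1" using assms(1) pos_le_divide_eq[of a 2] by simp
  then show ?thesis by (simp add: bump_eq_0)
qed

lemma integrable_radial_bump:
  assumes "0 < a" shows "integrable lebesgue (\<lambda>\<zeta>. bump ((cmod (\<zeta> - z))\<^sup>2 / a - 1) / a)"
    "integrable lborel (\<lambda>\<zeta>. bump ((cmod (\<zeta> - z))\<^sup>2 / a - 1) / a)"
proof -
  have "bump ((cmod (\<zeta> - z))\<^sup>2 / a - 1) / a = 0" if "\<zeta> \<notin> cball z (sqrt (2 * a))" for \<zeta>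
    using radial_bump_eq_0[of a "sqrt (2 * a)" \<zeta> z] assms that by auto
  then show "integrable lebesgue (\<lambda>\<zeta>. bump ((cmod (\<zeta> - z))\<^sup>2 / a - 1) / a)"
    "integrable lborel (\<lambda>\<zeta>. bump ((cmod (\<zeta> - z))\<^sup>2 / a - 1) / a)"
    using integrable_lebesgue_compact_support[OF continuous_radial_bump[of UNIV z a] compact_cball] by blast+
qed

text \<open>The factor \<open>1 / a\<close> is the Jacobian of the scaling by \<open>sqrt a\<close> in the plane.\<close>

lemma integral_radial_bump:
  assumes "0 < a" shows "(\<integral>\<zeta>. bump ((cmod (\<zeta> - z))\<^sup>2 / a - 1) / a \<partial>lebesgue) = bump_mass"
proof -
  let ?F = "\<lambda>\<zeta>. bump ((cmod (\<zeta> - z))\<^sup>2 / a - 1) / a"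
  have m: "?F \<in> borel_measurable borel"
    by (intro borel_measurable_continuous_onI continuous_radial_bump)
  have "(\<lambda>\<zeta>. bump ((cmod \<zeta>)\<^sup>2 - 1)) \<in> borel_measurable borel"
    using borel_measurable_continuous_onI[OF continuous_radial_bump[of UNIV 0 1]] by simp
  note m' = this
  have l: "(lborel :: complex measure) = density (distr lborel borel (\<lambda>x. z + sqrt a *\<^sub>R x)) (\<lambda>_. \<bar>sqrt a\<bar>^DIM(complex))"
    using assms by (intro lborel_affine) auto
  have "(\<integral>\<zeta>. ?F \<zeta> \<partial>lebesgue) = (\<integral>\<zeta>. ?F \<zeta> \<partial>lborel)"
    using m by (intro integral_completion) simp
  also have "\<dots> = (\<integral>\<zeta>. ?F \<zeta> \<partial>density (distr lborel borel (\<lambda>x. z + sqrt a *\<^sub>R x)) (\<lambda>_. \<bar>sqrt a\<bar>^DIM(complex)))"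
    by (subst l) simp
  also have "\<dots> = (\<integral>\<zeta>. a * ?F \<zeta> \<partial>distr lborel borel (\<lambda>x. z + sqrt a *\<^sub>R x))"
    using assms m by (subst integral_density) (auto simp: DIM_complex)
  also have "\<dots> = (\<integral>\<zeta>. a * ?F (z + sqrt a *\<^sub>R \<zeta>) \<partial>lborel)"
    by (rule integral_distr) (simp, rule borel_measurable_times[OF borel_measurable_const m])
  also have "\<dots> = (\<integral>\<zeta>. bump ((cmod \<zeta>)\<^sup>2 - 1) \<partial>lborel)"
    using assms by (intro Bochner_Integration.integral_cong) (auto simp: norm_mult power_mult_distrib)
  also have "\<dots> = bump_mass"
    unfolding bump_mass_def using m' by (intro integral_completion[symmetric]) simp
  finally show ?thesis .
qed

lemma bump_mass_pos: "0 < bump_mass"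
proof -
  let ?h = "\<lambda>\<zeta>. bump ((cmod \<zeta>)\<^sup>2 - 1)"
  have i: "integrable lborel ?h" using integrable_radial_bump(2)[of 1 0] by simp
  have c: "continuous_on UNIV ?h" using continuous_radial_bump[of UNIV 0 1] by simp
  have eq: "bump_mass = integral\<^sup>L lborel ?h"
    unfolding bump_mass_def using i by (intro integral_completion) simp
  have nn: "0 \<le> bump_mass" unfolding eq using bump_nonneg by (intro integral_nonneg_AE) auto
  have "bump_mass \<noteq> 0"
  proof
    assume "bump_mass = 0"
    then have "AE \<zeta> in lborel. ?h \<zeta> = 0"
      using integral_nonneg_eq_0_iff_AE[OF i] bump_nonneg by (simp add: eq)
    then have "AE \<zeta> in lborel. \<zeta> \<notin> {\<zeta>. ?h \<zeta> \<noteq> 0}" by simp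
    moreover have o: "open {\<zeta>. ?h \<zeta> \<noteq> 0}"
      by (intro open_Collect_neq c continuous_intros)
    ultimately have "{\<zeta>. ?h \<zeta> \<noteq> 0} \<in> null_sets lborel"
      by (subst AE_iff_null_sets) (auto simp: borel_open)
    then have "negligible {\<zeta>. ?h \<zeta> \<noteq> 0}"
      using negligible_iff_null_sets null_sets_completionI by blast
    then have "{\<zeta>. ?h \<zeta> \<noteq> 0} = {}"
      using open_not_negligible o by blast
    moreover have "?h (complex_of_real (sqrt (3/2))) \<noteq> 0"
      using bump_pos[of "1/2"] by simp
    ultimately show False by blast
  qed
  then show ?thesis using nn by simp
qed

text \<open>For a non-integrable function the left side is \<open>0\<close> by convention.\<close>

lemma norm_integral_le_nn_integral:
  fixes h :: "complex \<Rightarrow> bicomplex"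
  shows "ennreal (norm (integral\<^sup>L lebesgue h)) \<le> (\<integral>\<^sup>+\<zeta>. ennreal (norm (h \<zeta>)) \<partial>lebesgue)"
  by (cases "integrable lebesgue h")
     (auto simp: not_integrable_integral_eq intro: integral_norm_bound_ennreal)

text \<open>The average of \<open>f\<close> over the annulus at scale \<open>a\<close> tends to \<open>f z\<close> as \<open>a\<close> shrinks, because
  \<open>f\<close> is continuous, while the outer scale \<open>b = r\<^sup>2 / 2\<close> stays fixed.\<close>

lemma weak_dbar_center_estimate:
  fixes z :: complex and r :: real
  assumes dbar: "has_weak_dbar S f g" and S: "S \<in> sets lebesgue" and sub: "cball z r \<subseteq> S"
    and r: "0 < r" and cont: "continuous_on S f"
  shows "ennreal (bump_mass * norm (f z)) \<le>
     (\<integral>\<^sup>+\<zeta>\<in>ball z r. ennreal (2 / r\<^sup>2 * norm (f \<zeta>)) \<partial>lebesgue)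
   + (\<integral>\<^sup>+\<zeta>\<in>ball z r. ennreal (norm (g \<zeta>) / cmod (\<zeta> - z)) \<partial>lebesgue)" (is "_ \<le> ?I + ?J")
proof (rule ennreal_le_epsilon)
  fix e :: real assume e: "0 < e"
  define b where "b = r\<^sup>2 / 2"
  define \<eta> where "\<eta> = e / bump_mass"
  have \<eta>: "0 < \<eta>" using e bump_mass_pos by (simp add: \<eta>_def)
  define B where "B s \<zeta> = bump ((cmod (\<zeta> - z))\<^sup>2 / s - 1) / s" for s \<zeta>
  define X where "X s = integral\<^sup>L lebesgue (\<lambda>\<zeta>. B s \<zeta> *\<^sub>R f \<zeta>)" for s
  have zS: "z \<in> S" using sub r by auto
  obtain d where d: "0 < d" "\<And>\<zeta>. \<zeta> \<in> S \<Longrightarrow> dist \<zeta> z < d \<Longrightarrow> dist (f \<zeta>) (f z) < \<eta>"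
    using cont zS \<eta> unfolding continuous_on_iff by metis
  define d' where "d' = min d r"
  define a where "a = d'\<^sup>2 / 2"
  have d': "0 < d'" "d' \<le> r" using d r by (auto simp: d'_def)
  have ab: "0 < a" "a \<le> b" "2 * b \<le> r\<^sup>2" "0 \<le> r" "0 < b" "2 * a \<le> d'\<^sup>2" "2 * a \<le> r\<^sup>2"
    using d' r by (auto simp: a_def b_def power_mono)
  have Bnn: "0 \<le> B s \<zeta>" if "0 < s" for s \<zeta> using that bump_nonneg by (simp add: B_def)
  have B0: "B s \<zeta> = 0" if "0 < s" "2 * s \<le> \<rho>\<^sup>2" "0 \<le> \<rho>" "\<zeta> \<notin> ball z \<rho>" for s \<rho> \<zeta>
    using radial_bump_eq_0[OF that] by (simp add: B_def)
  have loc: "locally_integrable_on S f" using dbar by (simp add: has_weak_dbar_def)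
  have int: "integrable lebesgue (\<lambda>\<zeta>. B s \<zeta> *\<^sub>R f \<zeta>)" if "0 < s" "2 * s \<le> r\<^sup>2" for s
  proof -
    have "integrable lebesgue (\<lambda>\<zeta>. f \<zeta> * (B s \<zeta> *\<^sub>R 1))"
    proof (rule locally_integrable_mult(1)[OF loc compact_cball sub S])
      show "continuous_on UNIV (\<lambda>\<zeta>. B s \<zeta> *\<^sub>R (1::bicomplex))"
        unfolding B_def by (intro continuous_intros continuous_radial_bump)
      show "B s \<zeta> *\<^sub>R (1::bicomplex) = 0" if "\<zeta> \<notin> cball z r" for \<zeta>
        using B0[of s r \<zeta>] \<open>0 < s\<close> \<open>2 * s \<le> r\<^sup>2\<close> r that by auto
    qed
    then show ?thesis by (simp add: bc_mult_scaleR_right)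
  qed
  have intz: "integrable lebesgue (\<lambda>\<zeta>. B a \<zeta>)" and massz: "integral\<^sup>L lebesgue (B a) = bump_mass"
    using integrable_radial_bump(1)[OF ab(1)] integral_radial_bump[OF ab(1)] by (simp_all add: B_def[abs_def])
  obtain k where k: "\<And>\<zeta>. norm (g \<zeta> * (k ((cmod (\<zeta> - z))\<^sup>2) *\<^sub>R bc_cnj (\<zeta> - z))) \<le> norm (g \<zeta>) / cmod (\<zeta> - z) * indicator (ball z r) \<zeta>"
    "integral\<^sup>L lebesgue (\<lambda>\<zeta>. (B a \<zeta> - B b \<zeta>) *\<^sub>R f \<zeta>)
       = - integral\<^sup>L lebesgue (\<lambda>\<zeta>. g \<zeta> * (k ((cmod (\<zeta> - z))\<^sup>2) *\<^sub>R bc_cnj (\<zeta> - z)))"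
    using weak_dbar_two_scales[OF dbar S sub ab(1-4)] unfolding B_def by blast
  define Y where "Y = integral\<^sup>L lebesgue (\<lambda>\<zeta>. g \<zeta> * (k ((cmod (\<zeta> - z))\<^sup>2) *\<^sub>R bc_cnj (\<zeta> - z)))"
  \<comment> \<open>The averages of \<open>f\<close> at the inner and the outer scale differ by the kernel term.\<close>
  have "X a - X b = - Y"
    unfolding X_def Y_def k(2)[symmetric] scaleR_diff_left
    by (intro Bochner_Integration.integral_diff[symmetric] int ab)
  then have Xa: "norm (X a) \<le> norm (X b) + norm Y"
    by (metis add_diff_cancel_left' diff_add_cancel norm_minus_cancel norm_triangle_ineq add.commute)
  have "X a - bump_mass *\<^sub>R f z = integral\<^sup>L lebesgue (\<lambda>\<zeta>. B a \<zeta> *\<^sub>R (f \<zeta> - f z))"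
    unfolding X_def massz[symmetric] scaleR_diff_right
    using int[of a] intz ab by (subst Bochner_Integration.integral_diff) auto
  also have "norm \<dots> \<le> (\<integral>\<zeta>. norm (B a \<zeta> *\<^sub>R (f \<zeta> - f z)) \<partial>lebesgue)"
    by (rule integral_norm_bound)
  also have "\<dots> \<le> (\<integral>\<zeta>. B a \<zeta> * \<eta> \<partial>lebesgue)"
  proof (rule integral_mono)
    show "integrable lebesgue (\<lambda>\<zeta>. norm (B a \<zeta> *\<^sub>R (f \<zeta> - f z)))"
      unfolding scaleR_diff_right using int[of a] intz ab
      by (intro integrable_norm Bochner_Integration.integrable_diff) auto
    show "integrable lebesgue (\<lambda>\<zeta>. B a \<zeta> * \<eta>)" using intz by simp
    show "norm (B a \<zeta> *\<^sub>R (f \<zeta> - f z)) \<le> B a \<zeta> * \<eta>" for \<zeta>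
    proof (cases "\<zeta> \<in> ball z d'")
      case True
      then have "norm (f \<zeta> - f z) \<le> \<eta>"
        using d(2)[of \<zeta>] sub d' by (auto simp: dist_norm norm_minus_commute d'_def subset_iff)
      then show ?thesis using Bnn[OF ab(1), of \<zeta>] by (simp add: mult_left_mono)
    qed (use B0[OF ab(1,6)] d' in auto)
  qed
  also have "\<dots> = e" using massz bump_mass_pos by (simp add: \<eta>_def)
  finally have "norm (X a - bump_mass *\<^sub>R f z) \<le> e" .
  then have "norm (bump_mass *\<^sub>R f z) \<le> norm (X a) + e"
    using norm_triangle_ineq3[of "X a" "bump_mass *\<^sub>R f z"] by linarith
  then have main: "bump_mass * norm (f z) \<le> norm (X b) + norm Y + e"
    using Xa bump_mass_pos by simp
  have "ennreal (norm (X b)) \<le> (\<integral>\<^sup>+\<zeta>. ennreal (norm (B b \<zeta> *\<^sub>R f \<zeta>)) \<partial>lebesgue)"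
    unfolding X_def by (rule norm_integral_le_nn_integral)
  also have "\<dots> \<le> ?I"
  proof (rule nn_integral_mono)
    fix \<zeta>
    have "B b \<zeta> \<le> 2 / r\<^sup>2" using bump_le_1[of "(cmod (\<zeta> - z))\<^sup>2 / b - 1"] r
      by (simp add: B_def b_def field_simps)
    then show "ennreal (norm (B b \<zeta> *\<^sub>R f \<zeta>)) \<le> ennreal (2 / r\<^sup>2 * norm (f \<zeta>)) * indicator (ball z r) \<zeta>"
      using B0[OF ab(5,3,4), of \<zeta>] Bnn[OF ab(5), of \<zeta>]
      by (cases "\<zeta> \<in> ball z r") (auto intro!: ennreal_leI mult_right_mono simp del: times_divide_eq_left)
  qed
  finally have 1: "ennreal (norm (X b)) \<le> ?I" .
  have "ennreal (norm Y) \<le> (\<integral>\<^sup>+\<zeta>. ennreal (norm (g \<zeta> * (k ((cmod (\<zeta> - z))\<^sup>2) *\<^sub>R bc_cnj (\<zeta> - z)))) \<partial>lebesgue)"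
    unfolding Y_def by (rule norm_integral_le_nn_integral)
  also have "\<dots> \<le> ?J"
  proof (rule nn_integral_mono)
    fix \<zeta>
    show "ennreal (norm (g \<zeta> * (k ((cmod (\<zeta> - z))\<^sup>2) *\<^sub>R bc_cnj (\<zeta> - z)))) \<le> ennreal (norm (g \<zeta>) / cmod (\<zeta> - z)) * indicator (ball z r) \<zeta>"
      using ennreal_leI[OF k(1)[of \<zeta>]] by (cases "\<zeta> \<in> ball z r") auto
  qed
  finally have 2: "ennreal (norm Y) \<le> ?J" .
  have "ennreal (bump_mass * norm (f z)) \<le> ennreal (norm (X b)) + ennreal (norm Y) + ennreal e"
    using ennreal_leI[OF main] e by (simp add: ennreal_plus)
  also have "\<dots> \<le> ?I + ?J + ennreal e" using 1 2 by (intro add_mono) auto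
  finally show "ennreal (bump_mass * norm (f z)) \<le> ?I + ?J + ennreal e" .
qed

section \<open>Integration over disks\<close>

text \<open>Dyadic decomposition: on \<open>T / 2\<^sup>k\<^sup>+\<^sup>1 < X \<le> T / 2\<^sup>k\<close> the integrand is at most
  \<open>(T / 2\<^sup>k\<^sup>+\<^sup>1) powr (- s)\<close>, and the resulting series is geometric with ratio
  \<open>2 powr (s - a)\<close>. It is used for the distance to a point with \<open>a = 2\<close> and for the distance to
  the unit circle with \<open>a = 1\<close>.\<close>

lemma nn_integral_neg_powr_le:
  fixes X :: "'a \<Rightarrow> real"
  assumes X [measurable]: "X \<in> borel_measurable M" and T: "0 < T" and s: "0 \<le> s" "s < a" and C: "0 \<le> C"
    and tail: "\<And>\<tau>. 0 < \<tau> \<Longrightarrow> \<tau> \<le> T \<Longrightarrow> emeasure M {x \<in> space M. 0 < X x \<and> X x \<le> \<tau>} \<le> ennreal (C * \<tau> powr a)"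
  shows "(\<integral>\<^sup>+x\<in>{x. 0 < X x \<and> X x \<le> T}. ennreal (X x powr - s) \<partial>M)
     \<le> ennreal (C * 2 powr s / (1 - 2 powr (s - a)) * T powr (a - s))"
proof -
  define t where "t k = T / 2 ^ k" for k :: nat
  have t: "0 < t k" "t k \<le> T" for k using T by (auto simp: t_def field_simps)
  define E where "E k = {x \<in> space M. 0 < X x \<and> X x \<le> t k}" for k
  have E [measurable]: "E k \<in> sets M" for k unfolding E_def by measurable
  have "(\<integral>\<^sup>+x\<in>{x. 0 < X x \<and> X x \<le> T}. ennreal (X x powr - s) \<partial>M)
     \<le> (\<integral>\<^sup>+x. (\<Sum>k. ennreal (t (Suc k) powr - s) * indicator (E k) x) \<partial>M)"
  proof (rule nn_integral_mono)
    fix x assume x: "x \<in> space M"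
    show "ennreal (X x powr - s) * indicator {x. 0 < X x \<and> X x \<le> T} x
        \<le> (\<Sum>k. ennreal (t (Suc k) powr - s) * indicator (E k) x)"
    proof (cases "0 < X x \<and> X x \<le> T")
      case True
      define k where "k = nat \<lfloor>log 2 (T / X x)\<rfloor>"
      have y: "1 \<le> T / X x" using True by simp
      then have l: "0 \<le> log 2 (T / X x)" by simp
      then have rk: "real k \<le> log 2 (T / X x)" "log 2 (T / X x) < real (Suc k)"
        unfolding k_def by linarith+
      have "2 ^ k \<le> T / X x" using rk(1) y by (simp add: le_log_iff powr_realpow)
      then have k1: "X x \<le> t k" using True by (simp add: t_def field_simps)
      have "T / X x < 2 powr real (Suc k)" using rk(2) y log_less_iff[of 2 "T / X x" "real (Suc k)"] by simp
      then have "T / X x < 2 ^ Suc k" by (simp only: powr_realpow zero_less_numeral)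
      then have k2: "t (Suc k) \<le> X x" using True by (simp add: t_def field_simps)
      have "X x powr - s \<le> t (Suc k) powr - s"
        using k2 t s(1) by (intro powr_mono2') auto
      then have "ennreal (X x powr - s) \<le> ennreal (t (Suc k) powr - s) * indicator (E k) x"
        using True k1 x by (simp add: E_def ennreal_leI)
      also have "\<dots> \<le> (\<Sum>k. ennreal (t (Suc k) powr - s) * indicator (E k) x)"
        using ennreal_suminf_lessD linorder_not_less by blast
      finally show ?thesis using True by simp
    qed simp
  qed
  also have "\<dots> = (\<Sum>k. ennreal (t (Suc k) powr - s) * emeasure M (E k))"
    by (subst nn_integral_suminf) (auto simp: nn_integral_cmult_indicator)
  also have "\<dots> \<le> (\<Sum>k. ennreal (C * 2 powr s * T powr (a - s) * (2 powr (s - a)) ^ k))"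
  proof (rule suminf_le)
    fix k
    have "ennreal (t (Suc k) powr - s) * emeasure M (E k) \<le> ennreal (t (Suc k) powr - s) * ennreal (C * t k powr a)"
      unfolding E_def by (intro mult_left_mono tail t) auto
    also have "\<dots> = ennreal (t (Suc k) powr - s * (C * t k powr a))"
      by (simp add: ennreal_mult')
    also have "t (Suc k) powr - s * (C * t k powr a) = C * 2 powr s * T powr (a - s) * (2 powr (s - a)) ^ k"
    proof -
      have "t (Suc k) = T * 2 powr - real (Suc k)" "t k = T * 2 powr - real k"
        by (simp_all only: t_def powr_minus powr_realpow zero_less_numeral divide_inverse)
      then have "t (Suc k) powr - s = T powr - s * 2 powr (real (Suc k) * s)"
          "t k powr a = T powr a * 2 powr (- real k * a)"
        using T by (simp_all add: powr_mult powr_powr minus_mult_left[symmetric] del: of_nat_Suc)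
      moreover have pk: "(2 powr (s - a)) ^ k = 2 powr ((s - a) * real k)"
        by (simp add: powr_powr[symmetric] powr_realpow)
      moreover have "(2::real) powr (real (Suc k) * s) * 2 powr (- real k * a) = 2 powr s * 2 powr ((s - a) * real k)"
        by (simp add: powr_add[symmetric] algebra_simps)
      moreover have "T powr - s * T powr a = T powr (a - s)"
        by (simp add: powr_add[symmetric])
      moreover have "(A * B) * (C * (D * E)) = C * (B * E) * (A * D)" for A B C D E :: real
        by (simp add: mult_ac)
      ultimately show ?thesis by (simp only:) (simp add: mult_ac)
    qed
    finally show "ennreal (t (Suc k) powr - s) * emeasure M (E k) \<le> ennreal (C * 2 powr s * T powr (a - s) * (2 powr (s - a)) ^ k)" .
  qed auto
  also have "\<dots> = ennreal (C * 2 powr s * T powr (a - s) * (1 / (1 - 2 powr (s - a))))"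
  proof (rule suminf_ennreal_eq)
    have "(2::real) powr (s - a) < 1" using s powr_less_mono[of "s - a" 0 2] by simp
    then show "(\<lambda>k. C * 2 powr s * T powr (a - s) * (2 powr (s - a)) ^ k) sums (C * 2 powr s * T powr (a - s) * (1 / (1 - 2 powr (s - a))))"
      by (intro sums_mult geometric_sums) auto
  qed (use C in auto)
  finally show ?thesis by (simp add: mult_ac)
qed

lemma emeasure_lborel_disc:
  "0 \<le> r \<Longrightarrow> emeasure lborel (ball (z::complex) r) = ennreal (pi * r\<^sup>2)"
  "0 \<le> r \<Longrightarrow> emeasure lborel (cball (z::complex) r) = ennreal (pi * r\<^sup>2)"
  by (simp_all add: emeasure_ball emeasure_cball unit_ball_vol_2)

lemma nn_integral_radial_kernel_le:
  fixes z :: complex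
  assumes "0 < r" "0 \<le> s" "s < 2"
  shows "(\<integral>\<^sup>+\<zeta>\<in>ball z r. ennreal (cmod (\<zeta> - z) powr - s) \<partial>lborel)
     \<le> ennreal (pi * 2 powr s / (1 - 2 powr (s - 2)) * r powr (2 - s))"
proof -
  have "(\<integral>\<^sup>+\<zeta>\<in>ball z r. ennreal (cmod (\<zeta> - z) powr - s) \<partial>lborel)
     \<le> (\<integral>\<^sup>+\<zeta>\<in>{\<zeta>. 0 < cmod (\<zeta> - z) \<and> cmod (\<zeta> - z) \<le> r}. ennreal (cmod (\<zeta> - z) powr - s) \<partial>lborel)"
  proof (rule nn_integral_mono)
    fix \<zeta>
    show "ennreal (cmod (\<zeta> - z) powr - s) * indicator (ball z r) \<zeta> \<le>
      ennreal (cmod (\<zeta> - z) powr - s) * indicator {\<zeta>. 0 < cmod (\<zeta> - z) \<and> cmod (\<zeta> - z) \<le> r} \<zeta>"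
      by (auto simp: indicator_def dist_norm norm_minus_commute)
  qed
  also have "\<dots> \<le> ennreal (pi * 2 powr s / (1 - 2 powr (s - 2)) * r powr (2 - s))"
  proof (rule nn_integral_neg_powr_le)
    fix \<tau> :: real assume \<tau>: "0 < \<tau>"
    have "emeasure lborel {\<zeta> \<in> space lborel. 0 < cmod (\<zeta> - z) \<and> cmod (\<zeta> - z) \<le> \<tau>} \<le> emeasure lborel (cball z \<tau>)"
      by (intro emeasure_mono) (auto simp: dist_norm norm_minus_commute)
    then show "emeasure lborel {\<zeta> \<in> space lborel. 0 < cmod (\<zeta> - z) \<and> cmod (\<zeta> - z) \<le> \<tau>} \<le> ennreal (pi * \<tau> powr 2)"
      using \<tau> by (simp add: emeasure_lborel_disc)
  qed (use assms in auto)
  finally show ?thesis .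
qed

text \<open>Cartesian coordinates give access to Fubini's theorem, from which shear and rotation
  invariance follow.\<close>

lemma lborel_complex_eq_distr:
  "(lborel :: complex measure) = distr (lborel \<Otimes>\<^sub>M lborel) borel (\<lambda>(x, y). Complex x y)"
proof (rule lborel_eqI)
  have m: "(\<lambda>(x, y). Complex x y) \<in> borel_measurable (lborel \<Otimes>\<^sub>M lborel)"
    unfolding lborel_prod
    by (simp add: case_prod_unfold Complex_eq) (intro borel_measurable_continuous_onI continuous_intros)
  fix l u :: complex
  assume lu: "\<And>b. b \<in> Basis \<Longrightarrow> l \<bullet> b \<le> u \<bullet> b"
  have "Re l \<le> Re u" "Im l \<le> Im u" using lu[of 1] lu[of \<i>] by (auto simp: Basis_complex_def)
  have "(\<lambda>(x, y). Complex x y) -` box l u \<inter> space (lborel \<Otimes>\<^sub>M lborel) = {Re l<..<Re u} \<times> {Im l<..<Im u}"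
    by (auto simp: box_def Basis_complex_def space_pair_measure)
  then show "emeasure (distr (lborel \<Otimes>\<^sub>M lborel) borel (\<lambda>(x, y). Complex x y)) (box l u) = ennreal (\<Prod>b\<in>Basis. (u - l) \<bullet> b)"
    using m \<open>Re l \<le> Re u\<close> \<open>Im l \<le> Im u\<close>
    by (simp add: emeasure_distr lborel.emeasure_pair_measure_Times Basis_complex_def ennreal_mult')
qed simp

lemma nn_integral_lborel_complex:
  assumes [measurable]: "F \<in> borel_measurable borel"
  shows "(\<integral>\<^sup>+z. F z \<partial>lborel) = (\<integral>\<^sup>+y. \<integral>\<^sup>+x. F (Complex x y) \<partial>lborel \<partial>lborel)"
    and "(\<integral>\<^sup>+z. F z \<partial>lborel) = (\<integral>\<^sup>+x. \<integral>\<^sup>+y. F (Complex x y) \<partial>lborel \<partial>lborel)"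
proof -
  have m [measurable]: "(\<lambda>(x, y). Complex x y) \<in> borel_measurable (lborel \<Otimes>\<^sub>M lborel)"
    unfolding lborel_prod
    by (simp add: case_prod_unfold Complex_eq) (intro borel_measurable_continuous_onI continuous_intros)
  have Fm: "(\<lambda>(x, y). F (Complex x y)) \<in> borel_measurable (lborel \<Otimes>\<^sub>M lborel)"
    using measurable_compose[OF m assms] by (simp add: case_prod_unfold)
  have "(\<integral>\<^sup>+z. F z \<partial>lborel) = (\<integral>\<^sup>+p. (case p of (x, y) \<Rightarrow> F (Complex x y)) \<partial>(lborel \<Otimes>\<^sub>M lborel))"
    by (subst lborel_complex_eq_distr, subst nn_integral_distr) (auto simp: case_prod_unfold)
  then show "(\<integral>\<^sup>+z. F z \<partial>lborel) = (\<integral>\<^sup>+y. \<integral>\<^sup>+x. F (Complex x y) \<partial>lborel \<partial>lborel)"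
    and "(\<integral>\<^sup>+z. F z \<partial>lborel) = (\<integral>\<^sup>+x. \<integral>\<^sup>+y. F (Complex x y) \<partial>lborel \<partial>lborel)"
    using lborel_pair.nn_integral_snd[OF Fm] lborel.nn_integral_fst[OF Fm] by simp_all
qed

lemma nn_integral_shear:
  assumes [measurable]: "F \<in> borel_measurable borel"
  shows "(\<integral>\<^sup>+z. F (Complex (Re z + t * Im z) (Im z)) \<partial>lborel) = (\<integral>\<^sup>+z. F z \<partial>lborel)"
    and "(\<integral>\<^sup>+z. F (Complex (Re z) (Im z + t * Re z)) \<partial>lborel) = (\<integral>\<^sup>+z. F z \<partial>lborel)"
proof -
  have m [measurable]: "(\<lambda>z. Complex (Re z + t * Im z) (Im z)) \<in> borel_measurable borel"
    "(\<lambda>z. Complex (Re z) (Im z + t * Re z)) \<in> borel_measurable borel"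
    "(\<lambda>x. Complex x y) \<in> borel_measurable borel" "(\<lambda>x. Complex y x) \<in> borel_measurable borel" for y
    unfolding Complex_eq by (intro borel_measurable_continuous_onI continuous_intros)+
  have "(\<integral>\<^sup>+x. F (Complex (x + t * y) y) \<partial>lborel) = (\<integral>\<^sup>+x. F (Complex x y) \<partial>lborel)" for y
    using nn_integral_real_affine[of "\<lambda>x. F (Complex x y)" 1 "t * y"] by (simp add: add.commute)
  then show "(\<integral>\<^sup>+z. F (Complex (Re z + t * Im z) (Im z)) \<partial>lborel) = (\<integral>\<^sup>+z. F z \<partial>lborel)"
    by (subst (1 2) nn_integral_lborel_complex(1)) auto
  have "(\<integral>\<^sup>+y. F (Complex x (y + t * x)) \<partial>lborel) = (\<integral>\<^sup>+y. F (Complex x y) \<partial>lborel)" for x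
    using nn_integral_real_affine[of "\<lambda>y. F (Complex x y)" 1 "t * x"] by (simp add: add.commute)
  then show "(\<integral>\<^sup>+z. F (Complex (Re z) (Im z + t * Re z)) \<partial>lborel) = (\<integral>\<^sup>+z. F z \<partial>lborel)"
    by (subst (1 2) nn_integral_lborel_complex(2)) auto
qed

text \<open>A rotation by an angle \<open>\<theta>\<close> is a product of three shears, with parameters
  \<open>- tan (\<theta> / 2)\<close>, \<open>sin \<theta>\<close> and \<open>- tan (\<theta> / 2)\<close>. This fails only for the half-turn, which is
  avoided by rotating twice by the square root.\<close>

lemma nn_integral_rotate:
  assumes F: "F \<in> borel_measurable borel" and c: "cmod c = 1"
  shows "(\<integral>\<^sup>+z. F (c * z) \<partial>lborel) = (\<integral>\<^sup>+z. F z \<partial>lborel)"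
proof -
  have *: "(\<integral>\<^sup>+z. F (c * z) \<partial>lborel) = (\<integral>\<^sup>+z. F z \<partial>lborel)"
    if F: "F \<in> borel_measurable borel" and c: "cmod c = 1" "Re c \<noteq> - 1" for F and c :: complex
  proof -
    define t where "t = - Im c / (1 + Re c)"
    have c1: "(Re c)\<^sup>2 + (Im c)\<^sup>2 = 1" using c(1) by (simp add: cmod_def)
    have ti: "t * (1 + Re c) = - Im c" using c(2) by (simp add: t_def)
    have "(t * Im c) * (1 + Re c) = (Re c - 1) * (1 + Re c)"
    proof -
      have "(t * Im c) * (1 + Re c) = (t * (1 + Re c)) * Im c" by (simp only: mult_ac)
      also have "\<dots> = - (Im c)\<^sup>2" by (simp only: ti) (simp add: power2_eq_square)
      also have "\<dots> = (Re c)\<^sup>2 - 1" using c1 by linarith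
      finally show ?thesis by (simp add: algebra_simps power2_eq_square)
    qed
    then have ti2: "t * Im c = Re c - 1" using c(2) by auto
    define X where "X z = Complex (Re z + t * Im z) (Im z)" for z
    define Y where "Y z = Complex (Re z) (Im z + Im c * Re z)" for z
    have m: "X \<in> borel_measurable borel" "Y \<in> borel_measurable borel"
      unfolding Complex_eq X_def[abs_def] Y_def[abs_def] by (intro borel_measurable_continuous_onI continuous_intros)+
    have eq: "c * z = X (Y (X z))" for z
    proof -
      have "Im z + Im c * (Re z + t * Im z) = Im c * Re z + (1 + t * Im c) * Im z"
        by (simp add: algebra_simps)
      then have i: "Im z + Im c * (Re z + t * Im z) = Im c * Re z + Re c * Im z"
        by (simp only: ti2) simp
      have "Re z + t * Im z + t * (Im c * Re z + Re c * Im z) = (1 + t * Im c) * Re z + t * (1 + Re c) * Im z"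
        by (simp add: algebra_simps)
      also have "\<dots> = Re c * Re z - Im c * Im z" by (simp only: ti ti2) simp
      finally show ?thesis using i by (simp add: X_def Y_def complex_eq_iff)
    qed
    have "(\<integral>\<^sup>+z. F (X (Y (X z))) \<partial>lborel) = (\<integral>\<^sup>+z. F (X (Y z)) \<partial>lborel)"
      using nn_integral_shear(1)[of "\<lambda>z. F (X (Y z))" t] m F by (simp add: X_def[symmetric])
    also have "\<dots> = (\<integral>\<^sup>+z. F (X z) \<partial>lborel)"
      using nn_integral_shear(2)[of "\<lambda>z. F (X z)" "Im c"] m F by (simp add: Y_def[symmetric])
    also have "\<dots> = (\<integral>\<^sup>+z. F z \<partial>lborel)"
      using nn_integral_shear(1)[of F t] F by (simp add: X_def[symmetric])
    finally show ?thesis by (simp add: eq)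
  qed
  have d: "cmod (csqrt c) = 1" "Re (csqrt c) \<noteq> - 1"
    using c csqrt_principal[of c] by (auto simp: norm_csqrt simp del: csqrt.simps)
  have "(\<integral>\<^sup>+z. F (c * z) \<partial>lborel) = (\<integral>\<^sup>+z. F (csqrt c * (csqrt c * z)) \<partial>lborel)"
    by (metis (no_types) mult.assoc power2_csqrt power2_eq_square)
  also have "\<dots> = (\<integral>\<^sup>+z. F (csqrt c * z) \<partial>lborel)"
    using F by (intro *[of "\<lambda>z. F (csqrt c * z)"] d) auto
  also have "\<dots> = (\<integral>\<^sup>+z. F z \<partial>lborel)" by (rule *[OF F d])
  finally show ?thesis .
qed

text \<open>The shifted parameter interval is covered by two periods, which costs a factor \<open>2\<close> but
  spares cutting the interval.\<close>

lemma nn_integral_circle_rotate_le: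
  assumes G [measurable]: "G \<in> borel_measurable borel"
    and \<alpha>: "0 \<le> \<alpha>" "\<alpha> < 2 * pi"
  shows "(\<integral>\<^sup>+\<theta>\<in>{0..2*pi}. G (cis \<theta> * rcis r \<alpha>) \<partial>lborel) \<le> 2 * (\<integral>\<^sup>+\<theta>\<in>{0..2*pi}. G (rcis r \<theta>) \<partial>lborel)"
proof -
  have m [measurable]: "(\<lambda>\<theta>. rcis r \<theta>) \<in> borel_measurable borel"
    unfolding rcis_def cis_conv_exp by (intro borel_measurable_continuous_onI continuous_intros)
  have shift: "(\<integral>\<^sup>+\<theta>. H (\<theta> - t) \<partial>lborel) = (\<integral>\<^sup>+\<theta>. H \<theta> \<partial>lborel)" if "H \<in> borel_measurable borel" for H :: "real \<Rightarrow> ennreal" and t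
    using nn_integral_real_affine[OF that, of 1 "- t"] by simp
  have mm: "(\<lambda>\<theta>. G (rcis r \<theta>) * indicator {0..2*pi} (\<theta> - \<alpha>)) \<in> borel_measurable borel"
    "(\<lambda>\<theta>. G (rcis r \<theta>) * indicator {0..2*pi} \<theta>) \<in> borel_measurable borel"
  proof -
    have "(\<lambda>\<theta>. G (rcis r \<theta>)) \<in> borel_measurable borel" by (rule measurable_compose[OF m G])
    then show "(\<lambda>\<theta>. G (rcis r \<theta>) * indicator {0..2*pi} (\<theta> - \<alpha>)) \<in> borel_measurable borel"
      "(\<lambda>\<theta>. G (rcis r \<theta>) * indicator {0..2*pi} \<theta>) \<in> borel_measurable borel"
      by (intro borel_measurable_times_ennreal borel_measurable_indicator
          measurable_compose[of "\<lambda>\<theta>. \<theta> - \<alpha>" borel borel "indicator {0..2*pi}"]; simp)+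
  qed
  have "(\<integral>\<^sup>+\<theta>\<in>{0..2*pi}. G (cis \<theta> * rcis r \<alpha>) \<partial>lborel)
     = (\<integral>\<^sup>+\<theta>. G (rcis r (\<theta> - (- \<alpha>))) * indicator {0..2*pi} ((\<theta> - (- \<alpha>)) - \<alpha>) \<partial>lborel)"
  proof (intro nn_integral_cong)
    fix \<theta>
    have "cis \<theta> * rcis r \<alpha> = rcis r (\<theta> - (- \<alpha>))"
      by (simp add: cis_rcis_eq rcis_mult)
    then show "G (cis \<theta> * rcis r \<alpha>) * indicator {0..2*pi} \<theta>
      = G (rcis r (\<theta> - (- \<alpha>))) * indicator {0..2*pi} ((\<theta> - (- \<alpha>)) - \<alpha>)" by simp
  qed
  also have "\<dots> = (\<integral>\<^sup>+\<theta>. G (rcis r \<theta>) * indicator {0..2*pi} (\<theta> - \<alpha>) \<partial>lborel)"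
    using shift[OF mm(1), of "- \<alpha>"] .
  also have "\<dots> \<le> (\<integral>\<^sup>+\<theta>. G (rcis r \<theta>) * indicator {0..2*pi} \<theta> + G (rcis r (\<theta> - 2 * pi)) * indicator {0..2*pi} (\<theta> - 2 * pi) \<partial>lborel)"
  proof (rule nn_integral_mono)
    fix \<theta>
    have "rcis r (\<theta> - 2 * pi) = rcis r \<theta>"
      by (simp add: rcis_def cis_divide[symmetric] cis_2pi)
    then show "G (rcis r \<theta>) * indicator {0..2*pi} (\<theta> - \<alpha>) \<le> 
      G (rcis r \<theta>) * indicator {0..2*pi} \<theta> + G (rcis r (\<theta> - 2 * pi)) * indicator {0..2*pi} (\<theta> - 2 * pi)"
      using \<alpha> by (cases "\<theta> \<le> 2 * pi") (auto simp: indicator_def)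
  qed
  also have "\<dots> = (\<integral>\<^sup>+\<theta>\<in>{0..2*pi}. G (rcis r \<theta>) \<partial>lborel) + (\<integral>\<^sup>+\<theta>. G (rcis r (\<theta> - 2 * pi)) * indicator {0..2*pi} (\<theta> - 2 * pi) \<partial>lborel)"
    using mm(2) measurable_compose[OF _ mm(2), of "\<lambda>\<theta>. \<theta> - 2 * pi" borel] by (intro nn_integral_add) simp_all
  also have "(\<integral>\<^sup>+\<theta>. G (rcis r (\<theta> - 2 * pi)) * indicator {0..2*pi} (\<theta> - 2 * pi) \<partial>lborel) = (\<integral>\<^sup>+\<theta>\<in>{0..2*pi}. G (rcis r \<theta>) \<partial>lborel)"
    using shift[OF mm(2), of "2 * pi"] .
  finally show ?thesis by (simp only: mult_2[symmetric])
qed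

text \<open>A substitute for polar coordinates. By rotation invariance the integral over the disk equals
  its average over all rotations of \<open>G\<close>; after exchanging the order of integration the inner
  integral runs over a circle. The centre has no polar angle and is discarded as a null set.\<close>

lemma nn_integral_disk_le_circles:
  fixes G :: "complex \<Rightarrow> ennreal"
  assumes G [measurable]: "G \<in> borel_measurable borel" and h [measurable]: "h \<in> borel_measurable borel"
    and M: "\<And>r. 0 < r \<Longrightarrow> r < 1 \<Longrightarrow> (\<integral>\<^sup>+\<theta>\<in>{0..2*pi}. G (rcis r \<theta>) \<partial>lborel) \<le> M"
  shows "(\<integral>\<^sup>+z\<in>ball 0 1. h (cmod z) * G z \<partial>lborel) \<le> M * (\<integral>\<^sup>+z\<in>ball 0 1. h (cmod z) \<partial>lborel)"
proof -
  define H where "H z = h (cmod z) * indicator (ball 0 1) z" for z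
  have H [measurable]: "H \<in> borel_measurable borel"
    unfolding H_def[abs_def]
    by (intro borel_measurable_times_ennreal measurable_compose[OF _ h] borel_measurable_indicator) auto
  have Hrot: "H (cis \<theta> * z) = H z" for \<theta> z
    by (simp add: H_def norm_mult indicator_def)
  define I where "I = (\<integral>\<^sup>+z. H z * G z \<partial>lborel)"
  have cm [measurable]: "cis \<in> borel_measurable borel"
    unfolding cis_conv_exp[abs_def] by (intro borel_measurable_continuous_onI continuous_intros)
  have "ennreal (2 * pi) * I = (\<integral>\<^sup>+\<theta>. I * indicator {0..2*pi} \<theta> \<partial>lborel)"
    by (simp add: nn_integral_cmult_indicator mult.commute)
  also have "\<dots> = (\<integral>\<^sup>+\<theta>. (\<integral>\<^sup>+z. H z * G (cis \<theta> * z) \<partial>lborel) * indicator {0..2*pi} \<theta> \<partial>lborel)"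
    unfolding I_def using nn_integral_rotate[of "\<lambda>z. H z * G z" "cis \<theta>" for \<theta>, symmetric]
    by (simp add: Hrot)
  also have "\<dots> = (\<integral>\<^sup>+\<theta>. \<integral>\<^sup>+z. H z * (G (cis \<theta> * z) * indicator {0..2*pi} \<theta>) \<partial>lborel \<partial>lborel)"
    by (subst nn_integral_multc[symmetric]) (auto simp: mult_ac)
  also have "\<dots> = (\<integral>\<^sup>+z. \<integral>\<^sup>+\<theta>. H z * (G (cis \<theta> * z) * indicator {0..2*pi} \<theta>) \<partial>lborel \<partial>lborel)"
    by (rule lborel_pair.Fubini'[symmetric]) measurable
  also have "\<dots> = (\<integral>\<^sup>+z. H z * (\<integral>\<^sup>+\<theta>\<in>{0..2*pi}. G (cis \<theta> * z) \<partial>lborel) \<partial>lborel)"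
    by (subst nn_integral_cmult) auto
  also have "\<dots> \<le> (\<integral>\<^sup>+z. H z * (2 * M) \<partial>lborel)"
  proof (rule nn_integral_mono_AE)
    show "AE z in lborel. H z * (\<integral>\<^sup>+\<theta>\<in>{0..2*pi}. G (cis \<theta> * z) \<partial>lborel) \<le> H z * (2 * M)"
      using AE_lborel_singleton[of "0::complex"]
    proof eventually_elim
      fix z :: complex assume "z \<noteq> 0"
      show "H z * (\<integral>\<^sup>+\<theta>\<in>{0..2*pi}. G (cis \<theta> * z) \<partial>lborel) \<le> H z * (2 * M)"
      proof (cases "z \<in> ball 0 1")
        case True
        have z: "z = rcis (cmod z) (Arg2pi z)"
          using Arg2pi_eq[of z] by (simp add: rcis_def cis_conv_exp)
        have "(\<integral>\<^sup>+\<theta>\<in>{0..2*pi}. G (cis \<theta> * z) \<partial>lborel) \<le> 2 * (\<integral>\<^sup>+\<theta>\<in>{0..2*pi}. G (rcis (cmod z) \<theta>) \<partial>lborel)"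
          using nn_integral_circle_rotate_le[OF G Arg2pi_ge_0[of z] Arg2pi_lt_2pi[of z], of "cmod z"]
          by (simp add: z[symmetric])
        also have "\<dots> \<le> 2 * M"
          using True \<open>z \<noteq> 0\<close> by (intro mult_left_mono M) auto
        finally show ?thesis by (intro mult_left_mono) auto
      qed (simp add: H_def)
    qed
  qed
  also have "\<dots> = 2 * (M * (\<integral>\<^sup>+z. H z \<partial>lborel))"
    by (subst nn_integral_multc) (auto simp: mult_ac)
  finally have "ennreal (2 * pi) * I \<le> 2 * (M * (\<integral>\<^sup>+z. H z \<partial>lborel))" .
  moreover have "2 * I \<le> ennreal (2 * pi) * I"
    using pi_ge_two ennreal_leI[of 2 "2 * pi"] by (intro mult_right_mono) auto
  ultimately have "2 * I \<le> 2 * (M * (\<integral>\<^sup>+z. H z \<partial>lborel))" by (rule order_trans[rotated])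
  then have "I \<le> M * (\<integral>\<^sup>+z. H z \<partial>lborel)"
    by (simp add: ennreal_mult_le_mult_iff)
  then show ?thesis by (simp add: I_def H_def mult_ac)
qed

section \<open>The sub-mean-value inequality\<close>

lemma nn_integral_linear_combination:
  assumes "f \<in> borel_measurable M" "g \<in> borel_measurable M"
  shows "(\<integral>\<^sup>+x. a * f x + b * g x \<partial>M) = a * (\<integral>\<^sup>+x. f x \<partial>M) + b * (\<integral>\<^sup>+x. g x \<partial>M)"
  using assms by (simp add: nn_integral_add nn_integral_cmult)

text \<open>Young's inequality with a parameter \<open>l\<close> splits \<open>\<parallel>A\<parallel> / |\<zeta> - z|\<close> into \<open>(l \<parallel>A\<parallel>)\<^sup>q\<close>, whose integral
  is small for small \<open>l\<close>, and a multiple of \<open>|\<zeta> - z| powr (- s)\<close> with the conjugate exponent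
  \<open>s\<close>. The condition \<open>q > 2\<close> amounts to \<open>s < 2\<close>, which makes the second integral small on small
  disks.\<close>

lemma cauchy_kernel_small:
  fixes q \<kappa> :: real and A :: "complex \<Rightarrow> bicomplex"
  assumes q: "2 < q" and A: "A \<in> Lspace_disk q" and \<kappa>: "0 < \<kappa>"
  obtains \<rho> where "0 < \<rho>" "\<And>z r. 0 < r \<Longrightarrow> r \<le> \<rho> \<Longrightarrow> ball z r \<subseteq> ball 0 1 \<Longrightarrow>
     (\<integral>\<^sup>+\<zeta>\<in>ball z r. ennreal (norm (A \<zeta>) / cmod (\<zeta> - z)) \<partial>lebesgue) \<le> ennreal \<kappa>"
proof -
  define D where "D = ball (0::complex) 1"
  define A0 where "A0 \<zeta> = indicator D \<zeta> *\<^sub>R A \<zeta>" for \<zeta>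
  have A0m [measurable]: "A0 \<in> borel_measurable lebesgue"
    using A by (simp add: Lspace_disk_def borel_measurable_restrict_space_iff A0_def[abs_def] D_def)
  define N where "N = (\<integral>\<^sup>+\<zeta>. ennreal (norm (A0 \<zeta>) powr q) \<partial>lebesgue)"
  have "N = (\<integral>\<^sup>+\<zeta>. ennreal (norm (A \<zeta>) powr q) \<partial>lebesgue_on D)"
    unfolding N_def D_def
    by (subst nn_integral_restrict_space) (auto intro!: nn_integral_cong simp: A0_def D_def indicator_def)
  then have "N < \<infinity>" using A by (simp add: Lspace_disk_def D_def)
  then obtain L where L: "N = ennreal L" "0 \<le> L" by (cases N) auto
  \<comment> \<open>\<open>L + 1\<close> in place of \<open>L\<close> covers \<open>A = 0\<close>.\<close>
  define l where "l = (\<kappa> / (2 * (L + 1))) powr (1 / q)"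
  have l: "0 < l" using \<kappa> L by (simp add: l_def)
  have lq: "l powr q * L \<le> \<kappa> / 2"
  proof -
    have "l powr q = \<kappa> / (2 * (L + 1))" using q \<kappa> L by (simp add: l_def powr_powr)
    then have "l powr q * L = \<kappa> / 2 * (L / (L + 1))" by simp
    also have "\<dots> \<le> \<kappa> / 2 * 1" using \<kappa> L by (intro mult_left_mono) auto
    finally show ?thesis by simp
  qed
  define s where "s = q / (q - 1)"
  have s: "1 < s" "s < 2" "1 / q + 1 / s = 1" using q by (auto simp: s_def field_simps)
  define K where "K = pi * 2 powr s / (1 - 2 powr (s - 2))"
  have K: "0 < K" using s powr_less_mono[of "s - 2" 0 2] by (simp add: K_def)
  \<comment> \<open>The radius at which the bound \<open>(1 / l) powr s * K * \<rho> powr (2 - s)\<close> equals \<open>\<kappa> / 2\<close>.\<close>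
  define \<rho> where "\<rho> = (\<kappa> / (2 * K * (1 / l) powr s)) powr (1 / (2 - s))"
  have \<rho>: "0 < \<rho>" using \<kappa> K l by (simp add: \<rho>_def)
  have \<rho>s: "\<rho> powr (2 - s) = \<kappa> / (2 * K * (1 / l) powr s)" using s \<kappa> K l by (simp add: \<rho>_def powr_powr)
  show ?thesis
  proof (rule that[OF \<rho>])
    fix z :: complex and r :: real
    assume r: "0 < r" "r \<le> \<rho>" "ball z r \<subseteq> ball 0 1"
    have "(\<lambda>\<zeta>. cmod (\<zeta> - z)) \<in> borel_measurable lebesgue"
      by (intro lebesgue_measurable_continuous continuous_intros)
    then have km: "(\<lambda>\<zeta>. ennreal (cmod (\<zeta> - z) powr - s) * indicator (ball z r) \<zeta>) \<in> borel_measurable lebesgue"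
      by (intro borel_measurable_times_ennreal borel_measurable_indicator
          measurable_compose[OF _ measurable_ennreal] powr_real_measurable) auto
    have nm: "(\<lambda>\<zeta>. ennreal (norm (A0 \<zeta>) powr q)) \<in> borel_measurable lebesgue" by measurable
    have "(\<integral>\<^sup>+\<zeta>\<in>ball z r. ennreal (norm (A \<zeta>) / cmod (\<zeta> - z)) \<partial>lebesgue)
      \<le> (\<integral>\<^sup>+\<zeta>. ennreal (l powr q) * ennreal (norm (A0 \<zeta>) powr q) + ennreal ((1 / l) powr s) * (ennreal (cmod (\<zeta> - z) powr - s) * indicator (ball z r) \<zeta>) \<partial>lebesgue)"
    proof (rule nn_integral_mono)
      fix \<zeta>
      show "ennreal (norm (A \<zeta>) / cmod (\<zeta> - z)) * indicator (ball z r) \<zeta>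
        \<le> ennreal (l powr q) * ennreal (norm (A0 \<zeta>) powr q) + ennreal ((1 / l) powr s) * (ennreal (cmod (\<zeta> - z) powr - s) * indicator (ball z r) \<zeta>)"
      proof (cases "\<zeta> \<in> ball z r")
        case True
        then have A0: "A0 \<zeta> = A \<zeta>" using r by (auto simp: A0_def D_def)
        define x y where "x = l * norm (A \<zeta>)" "y = inverse (cmod (\<zeta> - z)) / l"
        have "norm (A \<zeta>) / cmod (\<zeta> - z) = x * y" using l by (simp add: x_y_def divide_inverse)
        also have "\<dots> \<le> x powr q / q + y powr s / s"
          using q s l by (intro Youngs_inequality) (auto simp: x_y_def)
        also have "\<dots> \<le> x powr q + y powr s"
          using q s by (intro add_mono) (auto simp: divide_le_eq mult_le_cancel_left1)
        also have "x powr q = l powr q * norm (A \<zeta>) powr q" using l by (simp add: x_y_def powr_mult)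
        also have "y powr s = (1 / l) powr s * cmod (\<zeta> - z) powr - s"
        proof -
          have "y = (1 / l) * inverse (cmod (\<zeta> - z))" by (simp add: x_y_def)
          then have "y powr s = (1 / l) powr s * inverse (cmod (\<zeta> - z)) powr s"
            using l by (simp only: powr_mult)
          then show ?thesis by (simp add: powr_minus inverse_powr)
        qed
        finally have "ennreal (norm (A \<zeta>) / cmod (\<zeta> - z)) \<le> ennreal (l powr q * norm (A \<zeta>) powr q + (1 / l) powr s * cmod (\<zeta> - z) powr - s)"
          by (rule ennreal_leI)
        then show ?thesis using True by (simp add: A0 ennreal_plus ennreal_mult')
      qed simp
    qed
    also have "\<dots> = ennreal (l powr q) * N + ennreal ((1 / l) powr s) * (\<integral>\<^sup>+\<zeta>\<in>ball z r. ennreal (cmod (\<zeta> - z) powr - s) \<partial>lborel)"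
      unfolding nn_integral_linear_combination[OF nm km] by (simp only: N_def nn_integral_completion)
    also have "\<dots> \<le> ennreal (l powr q) * ennreal L + ennreal ((1 / l) powr s) * ennreal (K * \<rho> powr (2 - s))"
    proof -
      have "(\<integral>\<^sup>+\<zeta>\<in>ball z r. ennreal (cmod (\<zeta> - z) powr - s) \<partial>lborel) \<le> ennreal (K * r powr (2 - s))"
        using nn_integral_radial_kernel_le[of r s z] r s by (simp add: K_def)
      also have "\<dots> \<le> ennreal (K * \<rho> powr (2 - s))"
        using r s K by (intro ennreal_leI mult_left_mono powr_mono2) auto
      finally show ?thesis using L by (intro add_mono mult_left_mono) auto
    qed
    also have "\<dots> = ennreal (l powr q * L + (1 / l) powr s * (K * \<rho> powr (2 - s)))"
      using L K by (simp add: ennreal_plus ennreal_mult')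
    also have "\<dots> \<le> ennreal \<kappa>"
    proof (rule ennreal_leI)
      have "(1 / l) powr s * (K * \<rho> powr (2 - s)) = \<kappa> / 2"
        using K l by (simp add: \<rho>s)
      then show "l powr q * L + (1 / l) powr s * (K * \<rho> powr (2 - s)) \<le> \<kappa>" using lq by simp
    qed
    finally show "(\<integral>\<^sup>+\<zeta>\<in>ball z r. ennreal (norm (A \<zeta>) / cmod (\<zeta> - z)) \<partial>lebesgue) \<le> ennreal \<kappa>" .
  qed
qed

text \<open>The point \<open>z1\<close> maximises \<open>\<parallel>f \<zeta>\<parallel> (\<rho> - |\<zeta> - z0|) powr (2 / p)\<close>, and \<open>\<delta>\<close> is half its distance
  to the boundary circle. On the disk of radius \<open>\<delta>\<close> about \<open>z1\<close> the weight drops at most by the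
  factor \<open>2 powr (2 / p)\<close>, hence \<open>\<parallel>f\<parallel>\<close> grows at most by that factor; comparing the values at \<open>z0\<close>
  and \<open>z1\<close> gives the last claim.\<close>

lemma weighted_maximum:
  fixes f :: "complex \<Rightarrow> bicomplex"
  assumes p: "0 < p" and \<rho>: "0 < \<rho>" and cont: "continuous_on (cball z0 \<rho>) f" and nz: "f z0 \<noteq> 0"
  obtains z1 \<delta> where "0 < \<delta>" "cball z1 \<delta> \<subseteq> cball z0 \<rho>" "ball z1 \<delta> \<subseteq> ball z0 \<rho>" "f z1 \<noteq> 0"
    "\<And>\<zeta>. \<zeta> \<in> ball z1 \<delta> \<Longrightarrow> norm (f \<zeta>) \<le> 2 powr (2 / p) * norm (f z1)"
    "norm (f z0) powr p * \<rho>\<^sup>2 \<le> 4 * \<delta>\<^sup>2 * norm (f z1) powr p"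
proof -
  define \<Phi> where "\<Phi> \<zeta> = norm (f \<zeta>) * (\<rho> - dist z0 \<zeta>) powr (2 / p)" for \<zeta>
  have "continuous_on (cball z0 \<rho>) \<Phi>"
    unfolding \<Phi>_def using p
    by (intro continuous_intros cont continuous_on_powr') auto
  then obtain z1 where z1: "z1 \<in> cball z0 \<rho>" "\<And>\<zeta>. \<zeta> \<in> cball z0 \<rho> \<Longrightarrow> \<Phi> \<zeta> \<le> \<Phi> z1"
    using continuous_attains_sup[of "cball z0 \<rho>" \<Phi>] \<rho> by auto
  have "0 < \<Phi> z0" using nz \<rho> by (simp add: \<Phi>_def)
  then have pos: "0 < \<Phi> z1" using z1(2)[of z0] \<rho> by simp
  define \<delta> where "\<delta> = (\<rho> - dist z0 z1) / 2"
  have "f z1 \<noteq> 0" "dist z0 z1 \<noteq> \<rho>" using pos by (auto simp: \<Phi>_def)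
  then have \<delta>: "0 < \<delta>" using z1(1) by (simp add: \<delta>_def)
  have d2: "2 * \<delta> = \<rho> - dist z0 z1" by (simp add: \<delta>_def)
  have sub: "dist z0 \<zeta> \<le> \<rho> - \<delta>" if "\<zeta> \<in> cball z1 \<delta>" for \<zeta>
    using dist_triangle[of z0 \<zeta> z1] that d2 by auto
  show ?thesis
  proof (rule that[OF \<delta> _ _ \<open>f z1 \<noteq> 0\<close>])
    show "cball z1 \<delta> \<subseteq> cball z0 \<rho>" using sub \<delta> by force
    show "ball z1 \<delta> \<subseteq> ball z0 \<rho>"
    proof
      fix \<zeta> assume "\<zeta> \<in> ball z1 \<delta>"
      then show "\<zeta> \<in> ball z0 \<rho>" using sub[of \<zeta>] \<delta> by simp
    qed
    show "norm (f \<zeta>) \<le> 2 powr (2 / p) * norm (f z1)" if "\<zeta> \<in> ball z1 \<delta>" for \<zeta>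
    proof -
      have \<zeta>: "dist z0 \<zeta> \<le> \<rho> - \<delta>" using sub that by simp
      have "norm (f \<zeta>) * \<delta> powr (2 / p) \<le> \<Phi> \<zeta>"
        unfolding \<Phi>_def using \<zeta> \<delta> p by (intro mult_left_mono powr_mono2) auto
      also have "\<dots> \<le> \<Phi> z1" using \<zeta> \<delta> by (intro z1) auto
      also have "\<dots> = 2 powr (2 / p) * norm (f z1) * \<delta> powr (2 / p)"
        using \<delta> by (simp add: \<Phi>_def d2[symmetric] powr_mult)
      finally show ?thesis using \<delta> by simp
    qed
    have "(norm (f z0) * \<rho> powr (2 / p)) powr p \<le> (norm (f z1) * (2 * \<delta>) powr (2 / p)) powr p"
      using z1(2)[of z0] \<rho> p by (intro powr_mono2) (auto simp: \<Phi>_def d2)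
    then show "norm (f z0) powr p * \<rho>\<^sup>2 \<le> 4 * \<delta>\<^sup>2 * norm (f z1) powr p"
      using p \<rho> \<delta> by (simp add: powr_mult powr_powr mult_ac)
  qed
qed

text \<open>This trades the first power of \<open>x\<close> for the \<open>p\<close>-th. For \<open>p \<le> 1\<close> the upper bound on \<open>x\<close>
  controls \<open>x powr (1 - p)\<close>; for \<open>p > 1\<close> it is large when \<open>x\<close> is small, and small \<open>x\<close> are absorbed
  into \<open>\<epsilon> * G\<close>.\<close>

lemma powr_interpolate:
  fixes x G \<Lambda> \<epsilon> p :: real
  assumes "0 < p" "0 \<le> x" "0 < G" "x \<le> \<Lambda> * G" "0 < \<epsilon>" "0 < \<Lambda>"
  shows "x \<le> \<epsilon> * G + max (\<Lambda> powr (1 - p)) (\<epsilon> powr (1 - p)) * G powr (1 - p) * x powr p"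
proof (cases "x \<le> \<epsilon> * G")
  case True
  have "0 \<le> max (\<Lambda> powr (1 - p)) (\<epsilon> powr (1 - p))" by (simp add: max_def)
  then have "0 \<le> max (\<Lambda> powr (1 - p)) (\<epsilon> powr (1 - p)) * G powr (1 - p) * x powr p"
    by (intro mult_nonneg_nonneg) auto
  then show ?thesis using True by linarith
next
  case False
  then have x: "0 < x" "\<epsilon> * G \<le> x" using assms mult_pos_pos[of \<epsilon> G] by linarith+
  have "x powr (1 - p) \<le> max (\<Lambda> powr (1 - p)) (\<epsilon> powr (1 - p)) * G powr (1 - p)"
  proof (cases "p \<le> 1")
    case True
    have "x powr (1 - p) \<le> (\<Lambda> * G) powr (1 - p)" using True x assms by (intro powr_mono2) auto
    also have "\<dots> = \<Lambda> powr (1 - p) * G powr (1 - p)" using assms by (simp add: powr_mult)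
    also have "\<dots> \<le> max (\<Lambda> powr (1 - p)) (\<epsilon> powr (1 - p)) * G powr (1 - p)"
      by (intro mult_right_mono) auto
    finally show ?thesis .
  next
    case False
    have "x powr (1 - p) \<le> (\<epsilon> * G) powr (1 - p)" using False x assms by (intro powr_mono2') auto
    also have "\<dots> = \<epsilon> powr (1 - p) * G powr (1 - p)" using assms by (simp add: powr_mult)
    also have "\<dots> \<le> max (\<Lambda> powr (1 - p)) (\<epsilon> powr (1 - p)) * G powr (1 - p)"
      by (intro mult_right_mono) auto
    finally show ?thesis .
  qed
  then have "x powr (1 - p) * x powr p \<le> max (\<Lambda> powr (1 - p)) (\<epsilon> powr (1 - p)) * G powr (1 - p) * x powr p"
    by (intro mult_right_mono) auto
  moreover have "x powr (1 - p) * x powr p = x" using x by (simp add: powr_add[symmetric])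
  moreover have "0 \<le> \<epsilon> * G" using assms by simp
  ultimately show ?thesis by linarith
qed

text \<open>The centre estimate is applied at the point and radius supplied by \<open>weighted_maximum\<close>. Both
  the part of the mean where \<open>\<parallel>f\<parallel>\<close> is small and the term with \<open>A\<close> are at most a quarter of the
  left side, by the choice of \<open>\<epsilon>\<close> and \<open>\<kappa>\<close>; what remains is the integral of \<open>\<parallel>f\<parallel>\<^sup>p\<close>.\<close>

lemma weak_dbar_sub_mean_value:
  fixes p :: real and S :: "complex set"
  assumes p: "0 < p" and S: "open S" and cont: "continuous_on S f"
    and dbar: "has_weak_dbar S f (\<lambda>z. A z * f z)" and Am: "A \<in> borel_measurable (lebesgue_on S)"
  obtains \<kappa> C where "0 < \<kappa>" "0 < C"
    "\<And>z0 \<rho>. 0 < \<rho> \<Longrightarrow> cball z0 \<rho> \<subseteq> S \<Longrightarrow>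
      (\<And>z r. 0 < r \<Longrightarrow> r \<le> \<rho> \<Longrightarrow> ball z r \<subseteq> S \<Longrightarrow>
        (\<integral>\<^sup>+\<zeta>\<in>ball z r. ennreal (norm (A \<zeta>) / cmod (\<zeta> - z)) \<partial>lebesgue) \<le> ennreal \<kappa>) \<Longrightarrow>
      ennreal (norm (f z0) powr p) \<le> ennreal (C / \<rho>\<^sup>2) * (\<integral>\<^sup>+\<zeta>\<in>ball z0 \<rho>. ennreal (norm (f \<zeta>) powr p) \<partial>lebesgue)"
proof -
  define c where "c = bump_mass"
  have c: "0 < c" using bump_mass_pos by (simp add: c_def)
  define \<Lambda> where "\<Lambda> = (2::real) powr (2 / p)"
  define \<kappa> where "\<kappa> = c / (4 * sqrt 2 * \<Lambda>)"
  define \<epsilon> where "\<epsilon> = c / (8 * pi)"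
  define K where "K = max (\<Lambda> powr (1 - p)) (\<epsilon> powr (1 - p))"
  define C where "C = 16 * K / c"
  have pos: "0 < \<Lambda>" "0 < \<kappa>" "0 < \<epsilon>" "0 < K" "0 < C"
    using c by (simp_all add: \<Lambda>_def \<kappa>_def \<epsilon>_def K_def C_def less_max_iff_disj)
  have Sl: "S \<in> sets lebesgue" using S by (simp add: borel_open)
  define A0 where "A0 \<zeta> = indicator S \<zeta> *\<^sub>R A \<zeta>" for \<zeta>
  have A0m [measurable]: "A0 \<in> borel_measurable lebesgue"
    using Am Sl by (simp add: borel_measurable_restrict_space_iff A0_def[abs_def])
  show ?thesis
  proof (rule that[OF pos(2,5)])
    fix z0 \<rho>
    assume \<rho>: "0 < \<rho>" "cball z0 \<rho> \<subseteq> S"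
      and ker: "\<And>z r. 0 < r \<Longrightarrow> r \<le> \<rho> \<Longrightarrow> ball z r \<subseteq> S \<Longrightarrow>
        (\<integral>\<^sup>+\<zeta>\<in>ball z r. ennreal (norm (A \<zeta>) / cmod (\<zeta> - z)) \<partial>lebesgue) \<le> ennreal \<kappa>"
    show "ennreal (norm (f z0) powr p) \<le> ennreal (C / \<rho>\<^sup>2) * (\<integral>\<^sup>+\<zeta>\<in>ball z0 \<rho>. ennreal (norm (f \<zeta>) powr p) \<partial>lebesgue)"
    proof (cases "f z0 = 0")
      case False
      obtain z1 \<delta> where z1: "0 < \<delta>" "cball z1 \<delta> \<subseteq> cball z0 \<rho>" "ball z1 \<delta> \<subseteq> ball z0 \<rho>" "f z1 \<noteq> 0"
        "\<And>\<zeta>. \<zeta> \<in> ball z1 \<delta> \<Longrightarrow> norm (f \<zeta>) \<le> \<Lambda> * norm (f z1)"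
        "norm (f z0) powr p * \<rho>\<^sup>2 \<le> 4 * \<delta>\<^sup>2 * norm (f z1) powr p"
        using weighted_maximum[OF p \<rho>(1) continuous_on_subset[OF cont \<rho>(2)] False] unfolding \<Lambda>_def by metis
      define G where "G = norm (f z1)"
      have G: "0 < G" using z1 by (simp add: G_def)
      have sub: "cball z1 \<delta> \<subseteq> S" "ball z1 \<delta> \<subseteq> S" using z1(2) \<rho>(2) ball_subset_cball by blast+
      have \<delta>\<rho>: "\<delta> \<le> \<rho>"
        using z1(3) z1(1) ball_subset_ball_iff[of z1 \<delta> z0 \<rho>] zero_le_dist[of z1 z0] by linarith
      define f0 where "f0 \<zeta> = indicator (ball z1 \<delta>) \<zeta> *\<^sub>R f \<zeta>" for \<zeta>
      have f0m [measurable]: "f0 \<in> borel_measurable lebesgue"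
      proof -
        have "(\<lambda>\<zeta>. indicator (ball z1 \<delta>) \<zeta> *\<^sub>R f \<zeta>) \<in> borel_measurable borel"
          using continuous_on_subset[OF cont sub(2)] by (intro borel_measurable_continuous_on_indicator) auto
        then show ?thesis by (simp add: measurable_completion f0_def[abs_def])
      qed
      define I where "I = (\<integral>\<^sup>+\<zeta>. ennreal (norm (f0 \<zeta>) powr p) \<partial>lebesgue)"
      have I_eq: "I = (\<integral>\<^sup>+\<zeta>\<in>ball z1 \<delta>. ennreal (norm (f \<zeta>) powr p) \<partial>lebesgue)"
        unfolding I_def by (intro nn_integral_cong) (simp add: f0_def indicator_def)
      have disc: "emeasure lebesgue (ball z1 \<delta>) = ennreal (pi * \<delta>\<^sup>2)"
        using emeasure_lborel_disc(1)[of \<delta> z1] z1(1) by simp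
      have "I \<le> (\<integral>\<^sup>+\<zeta>. ennreal ((\<Lambda> * G) powr p) * indicator (ball z1 \<delta>) \<zeta> \<partial>lebesgue)"
        unfolding I_eq using z1(5) p by (intro nn_integral_mono) (auto simp: indicator_def G_def intro!: ennreal_leI powr_mono2)
      also have "\<dots> < \<infinity>" by (simp add: nn_integral_cmult_indicator disc ennreal_mult'[symmetric])
      finally obtain i where i: "I = ennreal i" "0 \<le> i" by (cases I) auto
      have "ennreal (c * G) \<le> (\<integral>\<^sup>+\<zeta>\<in>ball z1 \<delta>. ennreal (2 / \<delta>\<^sup>2 * norm (f \<zeta>)) \<partial>lebesgue)
        + (\<integral>\<^sup>+\<zeta>\<in>ball z1 \<delta>. ennreal (norm (A \<zeta> * f \<zeta>) / cmod (\<zeta> - z1)) \<partial>lebesgue)"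
        unfolding c_def G_def by (rule weak_dbar_center_estimate[OF dbar Sl sub(1) z1(1) cont])
      also have "(\<integral>\<^sup>+\<zeta>\<in>ball z1 \<delta>. ennreal (2 / \<delta>\<^sup>2 * norm (f \<zeta>)) \<partial>lebesgue)
         \<le> ennreal (c * G / 4 + 2 / \<delta>\<^sup>2 * K * G powr (1 - p) * i)"
      proof -
        have "(\<integral>\<^sup>+\<zeta>\<in>ball z1 \<delta>. ennreal (2 / \<delta>\<^sup>2 * norm (f \<zeta>)) \<partial>lebesgue)
           \<le> (\<integral>\<^sup>+\<zeta>. ennreal (2 / \<delta>\<^sup>2 * \<epsilon> * G) * indicator (ball z1 \<delta>) \<zeta> 
              + ennreal (2 / \<delta>\<^sup>2 * K * G powr (1 - p)) * ennreal (norm (f0 \<zeta>) powr p) \<partial>lebesgue)"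
        proof (rule nn_integral_mono)
          fix \<zeta>
          show "ennreal (2 / \<delta>\<^sup>2 * norm (f \<zeta>)) * indicator (ball z1 \<delta>) \<zeta>
            \<le> ennreal (2 / \<delta>\<^sup>2 * \<epsilon> * G) * indicator (ball z1 \<delta>) \<zeta> 
              + ennreal (2 / \<delta>\<^sup>2 * K * G powr (1 - p)) * ennreal (norm (f0 \<zeta>) powr p)"
          proof (cases "\<zeta> \<in> ball z1 \<delta>")
            case True
            have "2 / \<delta>\<^sup>2 * norm (f \<zeta>) \<le> 2 / \<delta>\<^sup>2 * (\<epsilon> * G + K * G powr (1 - p) * norm (f \<zeta>) powr p)"
              unfolding K_def using True p G pos z1(5)
              by (intro mult_left_mono powr_interpolate) (auto simp: G_def)
            also have "\<dots> = 2 / \<delta>\<^sup>2 * \<epsilon> * G + 2 / \<delta>\<^sup>2 * K * G powr (1 - p) * norm (f \<zeta>) powr p"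
              by (simp only: distrib_left mult.assoc)
            finally have "ennreal (2 / \<delta>\<^sup>2 * norm (f \<zeta>)) \<le> ennreal (2 / \<delta>\<^sup>2 * \<epsilon> * G + 2 / \<delta>\<^sup>2 * K * G powr (1 - p) * norm (f \<zeta>) powr p)"
              by (rule ennreal_leI)
            also have "\<dots> = ennreal (2 / \<delta>\<^sup>2 * \<epsilon> * G) + ennreal (2 / \<delta>\<^sup>2 * K * G powr (1 - p)) * ennreal (norm (f \<zeta>) powr p)"
              using pos G z1(1) by (subst ennreal_mult'[symmetric], simp, subst ennreal_plus) auto
            finally show ?thesis using True by (simp add: f0_def)
          qed simp
        qed
        also have "\<dots> = ennreal (2 / \<delta>\<^sup>2 * \<epsilon> * G) * ennreal (pi * \<delta>\<^sup>2) + ennreal (2 / \<delta>\<^sup>2 * K * G powr (1 - p)) * ennreal i"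
        proof -
          have b: "ball z1 \<delta> \<in> sets lebesgue" by (simp add: borel_open)
          have "(\<lambda>\<zeta>. ennreal (norm (f0 \<zeta>) powr p)) \<in> borel_measurable lebesgue" by measurable
          from nn_integral_linear_combination[OF borel_measurable_indicator[OF b] this] show ?thesis
            by (simp only: nn_integral_indicator[OF b] disc I_def[symmetric] i)
        qed
        also have "\<dots> = ennreal (2 / \<delta>\<^sup>2 * \<epsilon> * G * (pi * \<delta>\<^sup>2) + 2 / \<delta>\<^sup>2 * K * G powr (1 - p) * i)"
          using pos G i z1(1) by (subst (1 2) ennreal_mult'[symmetric]) (auto simp: ennreal_plus[symmetric] simp del: ennreal_plus)
        also have "2 / \<delta>\<^sup>2 * \<epsilon> * G * (pi * \<delta>\<^sup>2) = c * G / 4"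
          using z1(1) by (simp add: \<epsilon>_def)
        finally show ?thesis .
      qed
      also have "(\<integral>\<^sup>+\<zeta>\<in>ball z1 \<delta>. ennreal (norm (A \<zeta> * f \<zeta>) / cmod (\<zeta> - z1)) \<partial>lebesgue) \<le> ennreal (c * G / 4)"
      proof -
        have "(\<integral>\<^sup>+\<zeta>\<in>ball z1 \<delta>. ennreal (norm (A \<zeta> * f \<zeta>) / cmod (\<zeta> - z1)) \<partial>lebesgue)
          \<le> (\<integral>\<^sup>+\<zeta>. ennreal (sqrt 2 * \<Lambda> * G) * (ennreal (norm (A0 \<zeta>) / cmod (\<zeta> - z1)) * indicator (ball z1 \<delta>) \<zeta>) \<partial>lebesgue)"
        proof (rule nn_integral_mono)
          fix \<zeta>
          show "ennreal (norm (A \<zeta> * f \<zeta>) / cmod (\<zeta> - z1)) * indicator (ball z1 \<delta>) \<zeta>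
            \<le> ennreal (sqrt 2 * \<Lambda> * G) * (ennreal (norm (A0 \<zeta>) / cmod (\<zeta> - z1)) * indicator (ball z1 \<delta>) \<zeta>)"
          proof (cases "\<zeta> \<in> ball z1 \<delta>")
            case True
            have "norm (A \<zeta> * f \<zeta>) \<le> sqrt 2 * norm (A \<zeta>) * norm (f \<zeta>)" by (rule norm_bc_mult_le)
            also have "\<dots> \<le> sqrt 2 * norm (A \<zeta>) * (\<Lambda> * G)"
              using z1(5)[OF True] by (intro mult_left_mono) (auto simp: G_def)
            finally have "norm (A \<zeta> * f \<zeta>) / cmod (\<zeta> - z1) \<le> sqrt 2 * norm (A \<zeta>) * (\<Lambda> * G) / cmod (\<zeta> - z1)"
              by (rule divide_right_mono) simp
            also have "\<dots> = (sqrt 2 * \<Lambda> * G) * (norm (A \<zeta>) / cmod (\<zeta> - z1))" by simp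
            finally have "ennreal (norm (A \<zeta> * f \<zeta>) / cmod (\<zeta> - z1)) \<le> ennreal ((sqrt 2 * \<Lambda> * G) * (norm (A \<zeta>) / cmod (\<zeta> - z1)))"
              by (rule ennreal_leI)
            also have "\<dots> = ennreal (sqrt 2 * \<Lambda> * G) * ennreal (norm (A \<zeta>) / cmod (\<zeta> - z1))"
              using pos G by (intro ennreal_mult) auto
            finally show ?thesis using True sub(2) by (auto simp: A0_def)
          qed simp
        qed
        also have "\<dots> = ennreal (sqrt 2 * \<Lambda> * G) * (\<integral>\<^sup>+\<zeta>. ennreal (norm (A0 \<zeta>) / cmod (\<zeta> - z1)) * indicator (ball z1 \<delta>) \<zeta> \<partial>lebesgue)"
        proof (rule nn_integral_cmult)
          have "(\<lambda>\<zeta>. cmod (\<zeta> - z1)) \<in> borel_measurable lebesgue"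
            by (intro lebesgue_measurable_continuous continuous_intros)
          then show "(\<lambda>\<zeta>. ennreal (norm (A0 \<zeta>) / cmod (\<zeta> - z1)) * indicator (ball z1 \<delta>) \<zeta>) \<in> borel_measurable lebesgue"
            by (intro borel_measurable_times_ennreal borel_measurable_indicator measurable_compose[OF _ measurable_ennreal] borel_measurable_divide) auto
        qed
        also have "(\<integral>\<^sup>+\<zeta>. ennreal (norm (A0 \<zeta>) / cmod (\<zeta> - z1)) * indicator (ball z1 \<delta>) \<zeta> \<partial>lebesgue)
            = (\<integral>\<^sup>+\<zeta>\<in>ball z1 \<delta>. ennreal (norm (A \<zeta>) / cmod (\<zeta> - z1)) \<partial>lebesgue)"
          using sub(2) by (intro nn_integral_cong) (auto simp: A0_def indicator_def)
        also have "ennreal (sqrt 2 * \<Lambda> * G) * \<dots> \<le> ennreal (sqrt 2 * \<Lambda> * G) * ennreal \<kappa>"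
          by (intro mult_left_mono ker z1(1) \<delta>\<rho> sub) auto
        also have "\<dots> = ennreal (sqrt 2 * \<Lambda> * G * \<kappa>)"
          using pos G by (intro ennreal_mult[symmetric]) auto
        also have "sqrt 2 * \<Lambda> * G * \<kappa> = c * G / 4" using pos by (simp add: \<kappa>_def)
        finally show ?thesis .
      qed
      finally have "ennreal (c * G) \<le> ennreal (c * G / 4 + 2 / \<delta>\<^sup>2 * K * G powr (1 - p) * i) + ennreal (c * G / 4)"
        by (simp add: add_mono)
      also have "\<dots> = ennreal (c * G / 4 + 2 / \<delta>\<^sup>2 * K * G powr (1 - p) * i + c * G / 4)"
        by (rule ennreal_plus[symmetric]) (use c G i pos in auto)
      finally have "ennreal (c * G) \<le> ennreal (c * G / 4 + 2 / \<delta>\<^sup>2 * K * G powr (1 - p) * i + c * G / 4)" .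
      then have "c * G \<le> c * G / 4 + 2 / \<delta>\<^sup>2 * K * G powr (1 - p) * i + c * G / 4"
        by (subst (asm) ennreal_le_iff) (use c G i pos in auto)
      then have "c / 2 * G \<le> 2 / \<delta>\<^sup>2 * K * G powr (1 - p) * i" by linarith
      also have "\<dots> = 2 / \<delta>\<^sup>2 * K * i * G powr (1 - p)" by (simp only: mult_ac)
      finally have "c / 2 * G \<le> 2 / \<delta>\<^sup>2 * K * i * G powr (1 - p)" .
      \<comment> \<open>Multiplying by \<open>G powr (p - 1)\<close> turns this into a bound on \<open>G powr p\<close>.\<close>
      then have "c / 2 * G * G powr (p - 1) \<le> 2 / \<delta>\<^sup>2 * K * i * G powr (1 - p) * G powr (p - 1)"
        by (rule mult_right_mono) simp
      moreover have "G * G powr (p - 1) = G powr p" "G powr (1 - p) * G powr (p - 1) = 1"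
        using G by (simp_all add: powr_add[symmetric] powr_mult_base)
      ultimately have "c / 2 * G powr p \<le> 2 / \<delta>\<^sup>2 * K * i" by (simp only: mult.assoc mult_1_right)
      then have "G powr p * (4 * \<delta>\<^sup>2) \<le> C * i"
        using c z1(1) by (simp add: C_def field_simps)
      then have "norm (f z0) powr p * \<rho>\<^sup>2 \<le> C * i" using z1(6) by (simp add: G_def mult_ac)
      then have "norm (f z0) powr p \<le> C / \<rho>\<^sup>2 * i" using \<rho>(1) by (simp add: field_simps)
      then have "ennreal (norm (f z0) powr p) \<le> ennreal (C / \<rho>\<^sup>2) * I"
        using pos i by (simp add: ennreal_mult[symmetric] ennreal_leI)
      also have "\<dots> \<le> ennreal (C / \<rho>\<^sup>2) * (\<integral>\<^sup>+\<zeta>\<in>ball z0 \<rho>. ennreal (norm (f \<zeta>) powr p) \<partial>lebesgue)"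
        unfolding I_eq using z1(3) by (intro mult_left_mono nn_integral_mono) (auto simp: indicator_def)
      finally show ?thesis .
    qed simp
  qed
qed

section \<open>Growth and integrability in the Hardy class\<close>

text \<open>For \<open>t < \<rho>\<close> there is no inner circle and the set is a disk of radius less than \<open>2 \<rho>\<close>, whose
  area is still at most linear in \<open>\<rho>\<close> since that radius is at most \<open>1\<close>.\<close>

lemma emeasure_annulus_le:
  fixes t \<rho> :: real
  assumes "0 \<le> t" "0 < \<rho>" "t + \<rho> \<le> 1"
  shows "emeasure lborel {\<zeta>::complex. t - \<rho> < cmod \<zeta> \<and> cmod \<zeta> < t + \<rho>} \<le> ennreal (4 * pi * \<rho>)"
proof (cases "\<rho> \<le> t")
  case True
  have "emeasure lborel {\<zeta>::complex. t - \<rho> < cmod \<zeta> \<and> cmod \<zeta> < t + \<rho>} \<le> emeasure lborel (ball (0::complex) (t + \<rho>) - cball 0 (t - \<rho>))"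
    by (intro emeasure_mono) auto
  also have "\<dots> = emeasure lborel (ball (0::complex) (t + \<rho>)) - emeasure lborel (cball (0::complex) (t - \<rho>))"
    using True assms by (intro emeasure_Diff) (auto simp: emeasure_lborel_disc)
  also have "\<dots> = ennreal (pi * (t + \<rho>)\<^sup>2 - pi * (t - \<rho>)\<^sup>2)"
    using True assms by (simp add: emeasure_lborel_disc ennreal_minus)
  also have "pi * (t + \<rho>)\<^sup>2 - pi * (t - \<rho>)\<^sup>2 = 4 * pi * \<rho> * t"
    by (simp add: power2_eq_square algebra_simps)
  also have "ennreal \<dots> \<le> ennreal (4 * pi * \<rho>)"
    using assms by (intro ennreal_leI mult_left_le) auto
  finally show ?thesis .
next
  case False
  have "emeasure lborel {\<zeta>::complex. t - \<rho> < cmod \<zeta> \<and> cmod \<zeta> < t + \<rho>} \<le> emeasure lborel (ball (0::complex) (t + \<rho>))"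
    by (intro emeasure_mono) auto
  also have "\<dots> = ennreal (pi * (t + \<rho>)\<^sup>2)"
    using assms by (simp add: emeasure_lborel_disc)
  also have "\<dots> \<le> ennreal (4 * pi * \<rho>)"
  proof (rule ennreal_leI)
    have "(t + \<rho>)\<^sup>2 \<le> (t + \<rho>) * 1" unfolding power2_eq_square using assms by (intro mult_left_mono) auto
    also have "\<dots> \<le> 4 * \<rho>" using False assms by simp
    finally show "pi * (t + \<rho>)\<^sup>2 \<le> 4 * pi * \<rho>" by simp
  qed
  finally show ?thesis .
qed

lemma nn_integral_boundary_distance_powr:
  assumes s: "0 \<le> s" "s < 1"
  shows "(\<integral>\<^sup>+z\<in>ball 0 1. ennreal ((1 - cmod z) powr - s) \<partial>lborel) < \<infinity>"
proof -
  have "(\<integral>\<^sup>+z\<in>ball 0 1. ennreal ((1 - cmod z) powr - s) \<partial>lborel)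
    = (\<integral>\<^sup>+z\<in>{z. 0 < 1 - cmod z \<and> 1 - cmod z \<le> 1}. ennreal ((1 - cmod z) powr - s) \<partial>lborel)"
    by (intro nn_integral_cong) (auto simp: indicator_def)
  also have "\<dots> \<le> ennreal (4 * pi * 2 powr s / (1 - 2 powr (s - 1)) * 1 powr (1 - s))"
  proof (rule nn_integral_neg_powr_le)
    fix \<tau> :: real assume \<tau>: "0 < \<tau>" "\<tau> \<le> 1"
    \<comment> \<open>The boundary layer of width \<open>\<tau>\<close> lies in the annulus of half-width \<open>\<tau>\<close> about the radius \<open>1 - \<tau>\<close>.\<close>
    have "emeasure lborel {z \<in> space lborel. 0 < 1 - cmod z \<and> 1 - cmod z \<le> \<tau>}
        \<le> emeasure lborel {z. (1 - \<tau>) - \<tau> < cmod z \<and> cmod z < (1 - \<tau>) + \<tau>}"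
      using \<tau> by (intro emeasure_mono) auto
    also have "\<dots> \<le> ennreal (4 * pi * \<tau>)" using \<tau> by (intro emeasure_annulus_le) auto
    finally show "emeasure lborel {z \<in> space lborel. 0 < 1 - cmod z \<and> 1 - cmod z \<le> \<tau>} \<le> ennreal (4 * pi * \<tau> powr 1)"
      using \<tau> by simp
  qed (use s in auto)
  also have "\<dots> < \<infinity>" by simp
  finally show ?thesis .
qed

text \<open>The sub-mean-value inequality is used at the radius \<open>\<rho>1 (1 - |z|)\<close>. The disk lies in an
  annulus of comparable width, over which the Hardy condition bounds the integral of \<open>\<parallel>w\<parallel>\<^sup>p\<close> by a
  multiple of the radius; dividing by the square of the radius leaves \<open>B / (1 - |z|)\<close>. The second
  conclusion is integration over circles, each circle contributing at most the Hardy supremum.\<close>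

lemma Hardy_disk_growth:
  assumes p: "0 < p" and q: "2 < q" and A: "A \<in> Lspace_disk q" and w: "w \<in> Hardy_disk p A"
  obtains B where "0 \<le> B" "\<And>z. cmod z < 1 \<Longrightarrow> norm (w z) powr p \<le> B / (1 - cmod z)"
    and "\<And>h. h \<in> borel_measurable borel \<Longrightarrow> (\<integral>\<^sup>+z\<in>ball 0 1. h (cmod z) \<partial>lborel) < \<infinity> \<Longrightarrow>
      (\<integral>\<^sup>+z\<in>ball 0 1. h (cmod z) * ennreal (norm (w z) powr p) \<partial>lborel) < \<infinity>"
proof -
  define D where "D = ball (0::complex) 1"
  have cont: "continuous_on D w" and dbar: "has_weak_dbar D w (\<lambda>z. A z * w z)"
    using w by (auto simp: Hardy_disk_def D_def)
  define M where "M = (SUP r\<in>{0<..<1}. \<integral>\<^sup>+ \<theta>. ennreal (norm (w (rcis r \<theta>)) powr p) \<partial>lebesgue_on {0..2*pi})"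
  have Mfin: "M < \<infinity>" using w by (simp add: Hardy_disk_def M_def)
  define G where "G z = ennreal (norm (indicator D z *\<^sub>R w z) powr p)" for z
  have "(\<lambda>z. indicator D z *\<^sub>R w z) \<in> borel_measurable borel"
    using cont by (intro borel_measurable_continuous_on_indicator) (auto simp: D_def)
  then have Gm: "G \<in> borel_measurable borel"
    unfolding G_def[abs_def] by measurable
  have GD: "G z = ennreal (norm (w z) powr p)" if "z \<in> D" for z using that by (simp add: G_def)
  have circ: "(\<integral>\<^sup>+\<theta>\<in>{0..2*pi}. G (rcis r \<theta>) \<partial>lborel) \<le> M" if "0 < r" "r < 1" for r
  proof -
    have "(\<integral>\<^sup>+\<theta>\<in>{0..2*pi}. G (rcis r \<theta>) \<partial>lborel) = (\<integral>\<^sup>+ \<theta>. ennreal (norm (w (rcis r \<theta>)) powr p) \<partial>lebesgue_on {0..2*pi})"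
      using that GD by (simp add: nn_integral_restrict_space nn_integral_completion D_def)
    also have "\<dots> \<le> M" unfolding M_def using that by (intro SUP_upper) auto
    finally show ?thesis .
  qed
  have radial: "(\<integral>\<^sup>+z\<in>D. h (cmod z) * ennreal (norm (w z) powr p) \<partial>lborel) \<le> M * (\<integral>\<^sup>+z\<in>D. h (cmod z) \<partial>lborel)"
    if h: "h \<in> borel_measurable borel" for h
  proof -
    have "(\<integral>\<^sup>+z\<in>D. h (cmod z) * ennreal (norm (w z) powr p) \<partial>lborel) = (\<integral>\<^sup>+z\<in>D. h (cmod z) * G z \<partial>lborel)"
      using GD by (intro nn_integral_cong) (auto simp: indicator_def)
    then show ?thesis using nn_integral_disk_le_circles[OF Gm h circ] by (simp add: D_def)
  qed
  obtain M' where M': "M = ennreal M'" "0 \<le> M'" using Mfin by (cases M) auto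
  have oD: "open D" and Am: "A \<in> borel_measurable (lebesgue_on D)"
    using A by (simp_all add: D_def Lspace_disk_def)
  obtain \<kappa> C where \<kappa>: "0 < \<kappa>" and C: "0 < C"
    and smv: "\<And>z0 \<rho>. 0 < \<rho> \<Longrightarrow> cball z0 \<rho> \<subseteq> D \<Longrightarrow>
      (\<And>z r. 0 < r \<Longrightarrow> r \<le> \<rho> \<Longrightarrow> ball z r \<subseteq> D \<Longrightarrow>
        (\<integral>\<^sup>+\<zeta>\<in>ball z r. ennreal (norm (A \<zeta>) / cmod (\<zeta> - z)) \<partial>lebesgue) \<le> ennreal \<kappa>) \<Longrightarrow>
      ennreal (norm (w z0) powr p) \<le> ennreal (C / \<rho>\<^sup>2) * (\<integral>\<^sup>+\<zeta>\<in>ball z0 \<rho>. ennreal (norm (w \<zeta>) powr p) \<partial>lebesgue)"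
    using weak_dbar_sub_mean_value[OF p oD cont dbar Am] by blast
  obtain \<rho>0 where \<rho>0: "0 < \<rho>0" and ker: "\<And>z r. 0 < r \<Longrightarrow> r \<le> \<rho>0 \<Longrightarrow> ball z r \<subseteq> D \<Longrightarrow>
     (\<integral>\<^sup>+\<zeta>\<in>ball z r. ennreal (norm (A \<zeta>) / cmod (\<zeta> - z)) \<partial>lebesgue) \<le> ennreal \<kappa>"
    using cauchy_kernel_small[OF q A \<kappa>] unfolding D_def by blast
  define \<rho>1 where "\<rho>1 = min \<rho>0 (1/2)"
  have \<rho>1: "0 < \<rho>1" "\<rho>1 \<le> \<rho>0" "\<rho>1 \<le> 1/2" using \<rho>0 by (auto simp: \<rho>1_def)
  define B where "B = 4 * pi * C * M' / \<rho>1"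
  show ?thesis
  proof (rule that)
    show "0 \<le> B" using C M' \<rho>1 by (simp add: B_def)
    show "norm (w z) powr p \<le> B / (1 - cmod z)" if z: "cmod z < 1" for z
    proof -
      define \<rho> where "\<rho> = \<rho>1 * (1 - cmod z)"
      have \<rho>: "0 < \<rho>" using \<rho>1 z by (simp add: \<rho>_def)
      have \<rho>': "\<rho> \<le> \<rho>0" "\<rho> \<le> (1 - cmod z) / 2"
      proof -
        have "\<rho>1 * (1 - cmod z) \<le> \<rho>1 * 1" using \<rho>1 by (intro mult_left_mono) auto
        then show "\<rho> \<le> \<rho>0" using \<rho>1 unfolding \<rho>_def by linarith
        have "\<rho>1 * (1 - cmod z) \<le> 1/2 * (1 - cmod z)" using \<rho>1 z by (intro mult_right_mono) auto
        then show "\<rho> \<le> (1 - cmod z) / 2" by (simp add: \<rho>_def)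
      qed
      have near: "cmod z - \<rho> < cmod \<zeta> \<and> cmod \<zeta> < cmod z + \<rho>" if "\<zeta> \<in> ball z \<rho>" for \<zeta>
        using that norm_triangle_ineq3[of z \<zeta>] by (auto simp: dist_norm abs_le_iff)
      have subD: "cball z \<rho> \<subseteq> D"
      proof
        fix \<zeta> assume "\<zeta> \<in> cball z \<rho>"
        then have "cmod \<zeta> \<le> cmod z + \<rho>"
          using norm_triangle_ineq3[of z \<zeta>] by (auto simp: dist_norm abs_le_iff)
        then show "\<zeta> \<in> D" using \<rho>' z by (simp add: D_def)
      qed
      define h where "h t = (indicator {cmod z - \<rho><..<cmod z + \<rho>} t :: ennreal)" for t
      have hm: "h \<in> borel_measurable borel" unfolding h_def[abs_def] by simp
      have "(\<integral>\<^sup>+\<zeta>\<in>ball z \<rho>. ennreal (norm (w \<zeta>) powr p) \<partial>lebesgue)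
          = (\<integral>\<^sup>+\<zeta>\<in>ball z \<rho>. ennreal (norm (w \<zeta>) powr p) \<partial>lborel)"
        by (rule nn_integral_completion)
      also have "\<dots> \<le> (\<integral>\<^sup>+\<zeta>\<in>D. h (cmod \<zeta>) * ennreal (norm (w \<zeta>) powr p) \<partial>lborel)"
      proof (rule nn_integral_mono)
        fix \<zeta>
        show "ennreal (norm (w \<zeta>) powr p) * indicator (ball z \<rho>) \<zeta> \<le> h (cmod \<zeta>) * ennreal (norm (w \<zeta>) powr p) * indicator D \<zeta>"
        proof (cases "\<zeta> \<in> ball z \<rho>")
          case True
          moreover have "\<zeta> \<in> D" using True subD ball_subset_cball[of z \<rho>] by blast
          ultimately show ?thesis using near[of \<zeta>] by (simp add: h_def)
        qed simp
      qed
      also have "\<dots> \<le> M * (\<integral>\<^sup>+\<zeta>\<in>D. h (cmod \<zeta>) \<partial>lborel)" by (rule radial[OF hm])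
      also have "(\<integral>\<^sup>+\<zeta>\<in>D. h (cmod \<zeta>) \<partial>lborel) \<le> (\<integral>\<^sup>+\<zeta>. indicator {\<zeta>::complex. cmod z - \<rho> < cmod \<zeta> \<and> cmod \<zeta> < cmod z + \<rho>} \<zeta> \<partial>lborel)"
        by (intro nn_integral_mono) (auto simp: h_def indicator_def)
      also have "\<dots> = emeasure lborel {\<zeta>::complex. cmod z - \<rho> < cmod \<zeta> \<and> cmod \<zeta> < cmod z + \<rho>}"
        by (intro nn_integral_indicator) simp
      also have "\<dots> \<le> ennreal (4 * pi * \<rho>)"
        using \<rho> \<rho>' z by (intro emeasure_annulus_le) auto
      finally have I: "(\<integral>\<^sup>+\<zeta>\<in>ball z \<rho>. ennreal (norm (w \<zeta>) powr p) \<partial>lebesgue) \<le> M * ennreal (4 * pi * \<rho>)"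
        by (simp add: mult_left_mono)
      have "ennreal (norm (w z) powr p) \<le> ennreal (C / \<rho>\<^sup>2) * (\<integral>\<^sup>+\<zeta>\<in>ball z \<rho>. ennreal (norm (w \<zeta>) powr p) \<partial>lebesgue)"
        by (rule smv[OF \<rho> subD]) (use ker \<rho>' in auto)
      also have "\<dots> \<le> ennreal (C / \<rho>\<^sup>2) * (ennreal M' * ennreal (4 * pi * \<rho>))"
        using I by (intro mult_left_mono) (auto simp: M')
      also have "\<dots> = ennreal (C / \<rho>\<^sup>2 * (M' * (4 * pi * \<rho>)))"
        using C M' \<rho> by (simp add: ennreal_mult[symmetric])
      also have "C / \<rho>\<^sup>2 * (M' * (4 * pi * \<rho>)) = B / (1 - cmod z)"
        using \<rho>1 z by (simp add: B_def \<rho>_def power2_eq_square)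
      finally show ?thesis
        using C M' \<rho>1 z by (subst (asm) ennreal_le_iff) (auto simp: B_def)
    qed
    fix h :: "real \<Rightarrow> ennreal"
    assume h: "h \<in> borel_measurable borel" "(\<integral>\<^sup>+z\<in>ball 0 1. h (cmod z) \<partial>lborel) < \<infinity>"
    have "M * (\<integral>\<^sup>+z\<in>D. h (cmod z) \<partial>lborel) < \<infinity>"
      using h(2) Mfin by (simp add: D_def ennreal_mult_less_top)
    then show "(\<integral>\<^sup>+z\<in>ball 0 1. h (cmod z) * ennreal (norm (w z) powr p) \<partial>lborel) < \<infinity>"
      using radial[OF h(1)] unfolding D_def by (rule le_less_trans[rotated])
  qed
qed

theorem theorem4p7:
  fixes p q :: real and A w :: "complex \<Rightarrow> bicomplex"
  assumes "p > 0" and "q > 2"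
    and "A \<in> Lspace_disk q"
    and "w \<in> Hardy_disk p A"
  shows "\<forall>m. 0 < m \<and> m < 2 * p \<longrightarrow> w \<in> Lspace_disk m"
proof (intro allI impI)
  fix m assume m: "0 < m \<and> m < 2 * p"
  obtain B where B: "0 \<le> B" "\<And>z. cmod z < 1 \<Longrightarrow> norm (w z) powr p \<le> B / (1 - cmod z)"
    and radial: "\<And>h. h \<in> borel_measurable borel \<Longrightarrow> (\<integral>\<^sup>+z\<in>ball 0 1. h (cmod z) \<partial>lborel) < \<infinity> \<Longrightarrow>
      (\<integral>\<^sup>+z\<in>ball 0 1. h (cmod z) * ennreal (norm (w z) powr p) \<partial>lborel) < \<infinity>"
    using Hardy_disk_growth[OF assms] by blast
  define D where "D = ball (0::complex) 1"
  have cont: "continuous_on D w" using assms(4) by (simp add: Hardy_disk_def D_def)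
  \<comment> \<open>The exponent is raised to at least \<open>p\<close>, so that the weight \<open>(1 - |z|) powr (- s)\<close> has \<open>s \<ge> 0\<close>.\<close>
  define s where "s = (max m p - p) / p"
  have s: "0 \<le> s" "s < 1" using assms(1) m by (auto simp: s_def field_simps)
  have mp: "max m p = s * p + p" using assms(1) by (simp add: s_def)
  define h where "h t = ennreal (B powr s) * ennreal ((1 - t) powr - s)" for t
  have hm: "h \<in> borel_measurable borel" unfolding h_def[abs_def] by measurable
  have bound: "norm (w z) powr m \<le> 1 + (B powr s * (1 - cmod z) powr - s) * norm (w z) powr p" if "z \<in> D" for z
  proof -
    have z: "cmod z < 1" using that by (simp add: D_def)
    have "norm (w z) powr m \<le> 1 + norm (w z) powr (max m p)"
    proof (cases "norm (w z) \<le> 1")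
      case True
      then have "norm (w z) powr m \<le> 1 powr m" using m by (intro powr_mono2) auto
      then show ?thesis using powr_ge_zero[of "norm (w z)" "max m p"] by (simp add: add_increasing2)
    next
      case False
      then have "norm (w z) powr m \<le> norm (w z) powr (max m p)" by (intro powr_mono) auto
      then show ?thesis by simp
    qed
    also have "norm (w z) powr (max m p) = (norm (w z) powr p) powr s * norm (w z) powr p"
      by (simp only: mp powr_add powr_powr mult.commute[of s])
    also have "\<dots> \<le> (B / (1 - cmod z)) powr s * norm (w z) powr p"
      using B(2)[OF z] s by (intro mult_right_mono powr_mono2) auto
    also have "(B / (1 - cmod z)) powr s = B powr s * (1 - cmod z) powr - s"
      using B(1) z by (simp add: powr_divide powr_minus_divide)
    finally show ?thesis by simp
  qed
  define F where "F z = ennreal (norm (indicator D z *\<^sub>R w z) powr p)" for z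
  have "(\<lambda>z. indicator D z *\<^sub>R w z) \<in> borel_measurable borel"
    using cont by (intro borel_measurable_continuous_on_indicator) (auto simp: D_def)
  then have Fm: "F \<in> borel_measurable borel"
    unfolding F_def[abs_def] by measurable
  have D: "D \<in> sets borel" by (simp add: D_def)
  have hF: "(\<lambda>z. h (cmod z) * F z * indicator D z) \<in> borel_measurable lborel"
    using Fm D measurable_compose[OF borel_measurable_norm hm]
    by (intro borel_measurable_times_ennreal borel_measurable_indicator) simp_all
  have "(\<integral>\<^sup>+z. ennreal (norm (w z) powr m) \<partial>lebesgue_on D) = (\<integral>\<^sup>+z. ennreal (norm (w z) powr m) * indicator D z \<partial>lborel)"
    using D by (simp add: nn_integral_restrict_space nn_integral_completion)
  also have "\<dots> \<le> (\<integral>\<^sup>+z. indicator D z + h (cmod z) * F z * indicator D z \<partial>lborel)"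
  proof (rule nn_integral_mono)
    fix z
    show "ennreal (norm (w z) powr m) * indicator D z \<le> indicator D z + h (cmod z) * F z * indicator D z"
    proof (cases "z \<in> D")
      case True
      have "ennreal (norm (w z) powr m) \<le> ennreal (1 + (B powr s * (1 - cmod z) powr - s) * norm (w z) powr p)"
        by (rule ennreal_leI[OF bound[OF True]])
      also have "\<dots> = 1 + h (cmod z) * F z"
        using True by (simp add: ennreal_mult ennreal_plus h_def F_def)
      finally show ?thesis using True by simp
    qed simp
  qed
  also have "\<dots> = emeasure lborel D + (\<integral>\<^sup>+z\<in>D. h (cmod z) * F z \<partial>lborel)"
    using D hF by (subst nn_integral_add) auto
  also have "\<dots> < \<infinity>"
  proof -
    have "(\<integral>\<^sup>+z\<in>D. h (cmod z) \<partial>lborel) = ennreal (B powr s) * (\<integral>\<^sup>+z\<in>D. ennreal ((1 - cmod z) powr - s) \<partial>lborel)"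
      unfolding h_def mult.assoc using D by (intro nn_integral_cmult borel_measurable_times_ennreal) auto
    also have "\<dots> < \<infinity>"
      using nn_integral_boundary_distance_powr[OF s] by (simp add: D_def ennreal_mult_less_top)
    finally have "(\<integral>\<^sup>+z\<in>ball 0 1. h (cmod z) * ennreal (norm (w z) powr p) \<partial>lborel) < \<infinity>"
      unfolding D_def by (rule radial[OF hm])
    also have "(\<integral>\<^sup>+z\<in>ball 0 1. h (cmod z) * ennreal (norm (w z) powr p) \<partial>lborel) = (\<integral>\<^sup>+z\<in>D. h (cmod z) * F z \<partial>lborel)"
      by (intro nn_integral_cong) (auto simp: F_def D_def indicator_def)
    finally show ?thesis
      by (simp add: D_def emeasure_lborel_disc)
  qed
  finally have "(\<integral>\<^sup>+z. ennreal (norm (w z) powr m) \<partial>lebesgue_on D) < \<infinity>" .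
  moreover have "w \<in> borel_measurable (lebesgue_on D)"
    using cont by (intro continuous_imp_measurable_on_sets_lebesgue) (auto simp: D_def)
  ultimately show "w \<in> Lspace_disk m"
    by (simp add: Lspace_disk_def D_def)
qed

end
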